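(* Let $\varphi:\mathbb{R}^n\to\mathbb{R}^m$ be continuous, let $g:\mathbb{R}^m\to\overline{\mathbb{R}}$ be lower semicontinuous and finite at $\varphi(\bar x)$, where $\bar x\in\mathbb{R}^n$, and set $f=g\circ\varphi$. Given a direction $(h,\nu)\in\mathbb{R}^n\times\mathbb{R}$, assume that the set-valued mapping $F:\mathbb{R}^{n+1}\rightrightarrows\mathbb{R}^{m+1}$, $F(x,\alpha)=\mathrm{epi}\,g-(\varphi(x),\alpha)$, is metrically subregular at $((\bar x,f(\bar x)),(0,0))$ in direction $(h,\nu)$. Then $$\partial f(\bar x;(h,\nu))\subset\Big(\bigcup_{v\in D\varphi(\bar x)(h):\ \nu\in Dg(\varphi(\bar x))(v)}D^*\varphi(\bar x;(h,v))\,\partial g(\varphi(\bar x);(v,\nu))\Big)\cup\Big(\bigcup_{v\in D\varphi(\bar x)(0)\cap\mathbb{S}:\ 0\in Dg(\varphi(\bar x))(v)}D^*\varphi(\bar x;(0,v))\,\partial g(\varphi(\bar x);(v,0))\Big).$$ Moreover, if $\varphi$ is calm at $\bar x$ in direction $h$, then $$\partial f(\bar x;(h,\nu))\subset\bigcup_{v\in D\varphi(\bar x)(h):\ \nu\in Dg(\varphi(\bar x))(v)}D^*\varphi(\bar x;(h,v))\,\partial g(\varphi(\bar x);(v,\nu)).$$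
   Context: Euclidean norms are used; $\mathbb{S}$ is the unit sphere and $\mathbb{B}$ the closed unit ball; $t_k\downarrow0$ means $t_k>0$, $t_k\to0$; $d_A(x)$ is the distance from $x$ to $A$ ($d_\emptyset=\infty$); $\overline{\mathbb{R}}=\mathbb{R}\cup\{\pm\infty\}$. For $\Omega\subset\mathbb{R}^n$ and $x\in\Omega$: $T_\Omega(x)=\{u\mid\exists u_k\to u,\ t_k\downarrow0:\ x+t_ku_k\in\Omega\ \forall k\}$; $\hat N_\Omega(x)=\{\xi\mid\limsup_{x'\to x,\,x'\in\Omega}\langle\xi,x'-x\rangle/\|x'-x\|\le0\}$; both are empty if $x\notin\Omega$. The limiting normal cone in direction $u$ is $N_\Omega(x;u)=\{\xi\mid\exists t_k\downarrow0,\ u_k\to u,\ \xi_k\to\xi:\ \xi_k\in\hat N_\Omega(x+t_ku_k)\ \forall k\}$. For a single-valued $\varphi$: $D\varphi(x)(u)=\{v\mid(u,v)\in T_{\mathrm{gph}\,\varphi}(x,\varphi(x))\}$ and $D^*\varphi(x;(u,v))(\eta)=\{\xi\mid(\xi,-\eta)\in N_{\mathrm{gph}\,\varphi}((x,\varphi(x));(u,v))\}$; for a set $A$, $D^*\varphi(x;(u,v))A:=\bigcup_{\eta\in A}D^*\varphi(x;(u,v))(\eta)$. For $f:\mathbb{R}^n\to\overline{\mathbb{R}}$ finite at $x$: $\mathrm{epi}\,f=\{(z,\alpha)\in\mathbb{R}^{n+1}\mid\alpha\ge f(z)\}$; $\mathrm{gph}\,f=\{(z,f(z))\mid f(z)\in\mathbb{R}\}$;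 $Df(x)(u)=\{\mu\in\mathbb{R}\mid(u,\mu)\in T_{\mathrm{gph}\,f}(x,f(x))\}$; the limiting subdifferential in direction $(u,\mu)\in\mathbb{R}^{n+1}$ is $\partial f(x;(u,\mu))=\{\xi\in\mathbb{R}^n\mid(\xi,-1)\in N_{\mathrm{epi}\,f}((x,f(x));(u,\mu))\}$. A directional neighborhood of $u$ is a set containing $\mathcal{V}_{\rho,\delta}(u):=\{z\in\rho\mathbb{B}\mid\big\|\|u\|z-\|z\|u\big\|\le\delta\|z\|\|u\|\}$ for some $\rho,\delta>0$. A multifunction $F$ is metrically subregular at $(\bar z,\bar w)\in\mathrm{gph}\,F$ in direction $u$ if there are $\kappa>0$ and a directional neighborhood $\mathcal{U}$ of $u$ with $d_{F^{-1}(\bar w)}(z)\le\kappa\,d_{F(z)}(\bar w)$ for all $z\in\bar z+\mathcal{U}$. $\varphi$ is calm at $\bar x$ in direction $h$ if there are $\kappa>0$ and a directional neighborhood $\mathcal{U}$ of $h$ with $\|\varphi(x)-\varphi(\bar x)\|\le\kappa\|x-\bar x\|$ for all $x\in\bar x+\mathcal{U}$. *)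

theory Defs
  imports "HOL-Analysis.Analysis"
begin

definition tangent_cone :: "'a::real_normed_vector set \<Rightarrow> 'a \<Rightarrow> 'a set" where
  "tangent_cone \<Omega> x = {u. x \<in> \<Omega> \<and>
     (\<exists>(us :: nat \<Rightarrow> 'a) (t :: nat \<Rightarrow> real). us \<longlonglongrightarrow> u \<and> (\<forall>k. t k > 0) \<and> t \<longlonglongrightarrow> 0 \<and>
       (\<forall>k. x + t k *\<^sub>R us k \<in> \<Omega>))}"

text \<open>The \<open>Limsup\<close> is taken in \<open>ereal\<close>: at an isolated point of \<open>\<Omega>\<close> it is \<open>-\<infinity>\<close>, so that every
  vector is a regular normal there.\<close>

definition regular_normal_cone :: "'a::real_inner set \<Rightarrow> 'a \<Rightarrow> 'a set" where
  "regular_normal_cone \<Omega> x = {\<xi>. x \<in> \<Omega> \<and>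
     Limsup (at x within \<Omega>) (\<lambda>x'. ereal (inner \<xi> (x' - x) / norm (x' - x))) \<le> 0}"

definition dir_normal_cone :: "'a::real_inner set \<Rightarrow> 'a \<Rightarrow> 'a \<Rightarrow> 'a set" where
  "dir_normal_cone \<Omega> x u = {\<xi>.
     \<exists>(t :: nat \<Rightarrow> real) (us :: nat \<Rightarrow> 'a) (\<xi>s :: nat \<Rightarrow> 'a).
       (\<forall>k. t k > 0) \<and> t \<longlonglongrightarrow> 0 \<and> us \<longlonglongrightarrow> u \<and> \<xi>s \<longlonglongrightarrow> \<xi> \<and>
       (\<forall>k. \<xi>s k \<in> regular_normal_cone \<Omega> (x + t k *\<^sub>R us k))}"

definition gph :: "('a \<Rightarrow> 'b) \<Rightarrow> ('a \<times> 'b) set" where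
  "gph \<phi> = {(x, \<phi> x) | x. True}"

definition graph_deriv ::
    "('a::real_normed_vector \<Rightarrow> 'b::real_normed_vector) \<Rightarrow> 'a \<Rightarrow> 'a \<Rightarrow> 'b set" where
  "graph_deriv \<phi> x u = {v. (u, v) \<in> tangent_cone (gph \<phi>) (x, \<phi> x)}"

definition dir_coderiv ::
    "('a::real_inner \<Rightarrow> 'b::real_inner) \<Rightarrow> 'a \<Rightarrow> 'a \<times> 'b \<Rightarrow> 'b \<Rightarrow> 'a set" where
  "dir_coderiv \<phi> x uv \<eta> = {\<xi>. (\<xi>, - \<eta>) \<in> dir_normal_cone (gph \<phi>) (x, \<phi> x) uv}"

definition dir_coderiv_set ::
    "('a::real_inner \<Rightarrow> 'b::real_inner) \<Rightarrow> 'a \<Rightarrow> 'a \<times> 'b \<Rightarrow> 'b set \<Rightarrow> 'a set" where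
  "dir_coderiv_set \<phi> x uv A = (\<Union>\<eta>\<in>A. dir_coderiv \<phi> x uv \<eta>)"

definition lower_semicontinuous :: "('a::topological_space \<Rightarrow> ereal) \<Rightarrow> bool" where
  "lower_semicontinuous g \<longleftrightarrow> (\<forall>x. g x \<le> Liminf (at x) g)"

definition epi :: "('a \<Rightarrow> ereal) \<Rightarrow> ('a \<times> real) set" where
  "epi f = {(z, \<alpha>). ereal \<alpha> \<ge> f z}"

definition gph_ext :: "('a \<Rightarrow> ereal) \<Rightarrow> ('a \<times> real) set" where
  "gph_ext f = {(z, \<alpha>). f z = ereal \<alpha>}"

text \<open>The next two notions are meant for \<open>f\<close> finite at \<open>x\<close> only; \<open>real_of_ereal (f x)\<close> is then the
  value of \<open>f\<close> at \<open>x\<close>.\<close>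

definition graph_deriv_ext :: "('a::real_normed_vector \<Rightarrow> ereal) \<Rightarrow> 'a \<Rightarrow> 'a \<Rightarrow> real set" where
  "graph_deriv_ext f x u = {\<mu>. (u, \<mu>) \<in> tangent_cone (gph_ext f) (x, real_of_ereal (f x))}"

definition dir_subdifferential ::
    "('a::real_inner \<Rightarrow> ereal) \<Rightarrow> 'a \<Rightarrow> 'a \<times> real \<Rightarrow> 'a set" where
  "dir_subdifferential f x u\<mu> =
     {\<xi>. (\<xi>, - 1) \<in> dir_normal_cone (epi f) (x, real_of_ereal (f x)) u\<mu>}"

definition dir_nbhd_basic :: "real \<Rightarrow> real \<Rightarrow> 'a::real_normed_vector \<Rightarrow> 'a set" where
  "dir_nbhd_basic \<rho> \<delta> u =
     {z \<in> cball 0 \<rho>. norm (norm u *\<^sub>R z - norm z *\<^sub>R u) \<le> \<delta> * norm z * norm u}"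

definition dir_nbhd :: "'a::real_normed_vector \<Rightarrow> 'a set \<Rightarrow> bool" where
  "dir_nbhd u U \<longleftrightarrow> (\<exists>\<rho>>0. \<exists>\<delta>>0. dir_nbhd_basic \<rho> \<delta> u \<subseteq> U)"

text \<open>Not \<open>infdist\<close>: the distance to the empty set has to be \<open>\<infinity>\<close>.\<close>

definition edist_set :: "'a::metric_space set \<Rightarrow> 'a \<Rightarrow> ereal" where
  "edist_set A x = (INF a\<in>A. ereal (dist x a))"

definition metrically_subregular_dir ::
    "('a::real_normed_vector \<Rightarrow> 'b::real_normed_vector set) \<Rightarrow> 'a \<Rightarrow> 'b \<Rightarrow> 'a \<Rightarrow> bool" where
  "metrically_subregular_dir F z0 w0 u \<longleftrightarrow> w0 \<in> F z0 \<and>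
     (\<exists>\<kappa>>0. \<exists>U. dir_nbhd u U \<and>
       (\<forall>z \<in> (+) z0 ` U. edist_set {y. w0 \<in> F y} z \<le> ereal \<kappa> * edist_set (F z) w0))"

definition calm_dir ::
    "('a::real_normed_vector \<Rightarrow> 'b::real_normed_vector) \<Rightarrow> 'a \<Rightarrow> 'a \<Rightarrow> bool" where
  "calm_dir \<phi> x0 h \<longleftrightarrow>
     (\<exists>\<kappa>>0. \<exists>U. dir_nbhd h U \<and> (\<forall>x \<in> (+) x0 ` U. norm (\<phi> x - \<phi> x0) \<le> \<kappa> * norm (x - x0)))"

end

theory Submission
  imports Defs
begin

text \<open>
  Write \<open>q (x, \<alpha>) = (\<phi> x, \<alpha>)\<close>. The epigraph of \<open>g \<circ> \<phi>\<close> is the preimage of \<open>epi g\<close> under \<open>q\<close>, and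
  metric subregularity says that the distance from \<open>z\<close> to this preimage is at most
  \<open>\<kappa> * norm (q z - p)\<close> for every \<open>p \<in> epi g\<close>, as long as \<open>z\<close> stays in a directional neighbourhood of the
  given direction. A directional subgradient \<open>\<xi>\<close> comes from regular normals \<open>\<zeta> = (\<xi>\<^sub>k, - \<beta>\<^sub>k)\<close> to
  \<open>epi (g \<circ> \<phi>)\<close> at points \<open>z\<^sub>k = (x\<^sub>k, \<alpha>\<^sub>k)\<close> which eventually lie in the interior of that
  neighbourhood, so the estimate is available around each of them.

  Around one such point, exact penalization replaces the constraint \<open>q z \<in> epi g\<close> by the penalty
  \<open>L * norm (q z - p)\<close> with a free variable \<open>p \<in> epi g\<close> (\<open>penalty_of_regular_normal\<close>). This decouples
  \<open>\<phi>\<close>, which is merely continuous, from \<open>g\<close>: the remaining constraints are that \<open>(z, q z)\<close> lies on the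
  graph of \<open>q\<close> and \<open>p\<close> in \<open>epi g\<close>. Replacing the norms by the smooth functions
  \<open>sqrt (s\<^sup>2 + (norm w)\<^sup>2)\<close> and minimizing over a compact set yields, at points as close to
  \<open>(z\<^sub>k, q z\<^sub>k)\<close> as desired, a regular normal \<open>\<eta>\<close> to \<open>epi g\<close> and a regular normal \<open>(\<zeta> - e, - \<eta>)\<close> to the
  graph of \<open>q\<close> with a small error \<open>e\<close> (\<open>fuzzy_normals_of_penalty\<close>). Since \<open>q\<close> is the identity in the last
  variable, the latter is a normal to the graph of \<open>\<phi>\<close>, and the last component of \<open>\<eta>\<close> is within the
  error of \<open>- \<beta>\<^sub>k\<close> (\<open>fuzzy_normals_of_composite\<close>). The multipliers \<open>\<eta>\<close> are bounded by \<open>L\<close>, so a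
  subsequence converges.

  It remains to find the direction in which the nearby points approach \<open>(x0, \<phi> x0)\<close>. If the difference
  quotients \<open>(\<phi> x\<^sub>k - \<phi> x0) / t\<^sub>k\<close> have a bounded subsequence, they converge along a further one to
  some \<open>v\<close>, and the scale \<open>t\<^sub>k\<close> gives the direction \<open>(h, v)\<close>. Otherwise their norms tend to infinity, and
  on the coarser scale \<open>norm (\<phi> x\<^sub>k - \<phi> x0)\<close> the components \<open>h\<close> and \<open>\<nu>\<close> disappear while \<open>v\<close> becomes a
  unit vector; calmness rules this out. Both cases are instances of \<open>directional_limit\<close>.
\<close>

section \<open>Regular normals\<close>

lemma regular_normal_cone_iff:
  "\<xi> \<in> regular_normal_cone \<Omega> x \<longleftrightarrow> x \<in> \<Omega> \<and>
     (\<forall>\<epsilon>>0. \<exists>d>0. \<forall>x'\<in>\<Omega>. norm (x' - x) < d \<longrightarrow> inner \<xi> (x' - x) \<le> \<epsilon> * norm (x' - x))"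
proof -
  have "Limsup (at x within \<Omega>) (\<lambda>x'. ereal (inner \<xi> (x' - x) / norm (x' - x))) \<le> 0
     \<longleftrightarrow> (\<forall>\<epsilon>>0. \<forall>\<^sub>F x' in at x within \<Omega>. inner \<xi> (x' - x) / norm (x' - x) < \<epsilon>)"
    (is "?A \<longleftrightarrow> ?B")
  proof
    assume A: ?A
    show ?B
    proof (intro allI impI)
      fix \<epsilon> :: real
      assume "0 < \<epsilon>"
      then have "\<forall>\<^sub>F x' in at x within \<Omega>. ereal (inner \<xi> (x' - x) / norm (x' - x)) < ereal \<epsilon>"
        using A unfolding Limsup_le_iff by (metis ereal_less(2))
      then show "\<forall>\<^sub>F x' in at x within \<Omega>. inner \<xi> (x' - x) / norm (x' - x) < \<epsilon>"
        by simp
    qed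
  next
    assume B: ?B
    show ?A
      unfolding Limsup_le_iff
    proof (intro allI impI)
      fix y :: ereal
      assume "0 < y"
      then obtain \<epsilon> where \<epsilon>: "0 < ereal \<epsilon>" "ereal \<epsilon> < y"
        using ereal_dense2 by blast
      then have "\<forall>\<^sub>F x' in at x within \<Omega>. inner \<xi> (x' - x) / norm (x' - x) < \<epsilon>"
        using B by simp
      then show "\<forall>\<^sub>F x' in at x within \<Omega>. ereal (inner \<xi> (x' - x) / norm (x' - x)) < y"
        by (rule eventually_mono) (use \<epsilon>(2) in \<open>auto intro: less_trans[of _ "ereal \<epsilon>"]\<close>)
    qed
  qed
  also have "?B \<longleftrightarrow> (\<forall>\<epsilon>>0. \<exists>d>0. \<forall>x'\<in>\<Omega>. norm (x' - x) < d \<longrightarrow>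
      inner \<xi> (x' - x) \<le> \<epsilon> * norm (x' - x))" (is "_ \<longleftrightarrow> ?C")
  proof
    assume B: ?B
    show ?C
    proof (intro allI impI)
      fix \<epsilon> :: real
      assume "0 < \<epsilon>"
      then obtain d where d: "d > 0"
        "\<forall>x'\<in>\<Omega>. x' \<noteq> x \<and> dist x' x < d \<longrightarrow> inner \<xi> (x' - x) / norm (x' - x) < \<epsilon>"
        using B unfolding eventually_at by meson
      have "inner \<xi> (x' - x) \<le> \<epsilon> * norm (x' - x)" if "x' \<in> \<Omega>" "norm (x' - x) < d" for x'
      proof (cases "x' = x")
        case False
        then have "inner \<xi> (x' - x) / norm (x' - x) < \<epsilon>"
          using d(2) that by (auto simp: dist_norm)
        then show ?thesis
          using False by (simp add: field_simps)
      qed simp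
      then show "\<exists>d>0. \<forall>x'\<in>\<Omega>. norm (x' - x) < d \<longrightarrow> inner \<xi> (x' - x) \<le> \<epsilon> * norm (x' - x)"
        using d(1) by blast
    qed
  next
    assume C: ?C
    show ?B
    proof (intro allI impI)
      fix \<epsilon> :: real
      assume \<epsilon>: "0 < \<epsilon>"
      then obtain d where d: "d > 0"
        "\<forall>x'\<in>\<Omega>. norm (x' - x) < d \<longrightarrow> inner \<xi> (x' - x) \<le> (\<epsilon> / 2) * norm (x' - x)"
        using C half_gt_zero by blast
      have "inner \<xi> (x' - x) / norm (x' - x) < \<epsilon>"
        if "x' \<in> \<Omega>" "x' \<noteq> x" "dist x' x < d" for x'
      proof -
        have "inner \<xi> (x' - x) / norm (x' - x) \<le> \<epsilon> / 2"
          using d(2) that by (simp add: dist_norm field_simps)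
        then show ?thesis
          using \<epsilon> by linarith
      qed
      then show "\<forall>\<^sub>F x' in at x within \<Omega>. inner \<xi> (x' - x) / norm (x' - x) < \<epsilon>"
        unfolding eventually_at using d(1) by blast
    qed
  qed
  finally show ?thesis
    unfolding regular_normal_cone_def by simp
qed

lemma proximal_imp_regular_normal:
  fixes x :: "'a::real_inner"
  assumes "x \<in> \<Omega>" "d > 0" "c \<ge> 0"
    and prox: "\<And>x'. x' \<in> \<Omega> \<Longrightarrow> norm (x' - x) < d \<Longrightarrow> inner \<xi> (x' - x) \<le> c * (norm (x' - x))\<^sup>2"
  shows "\<xi> \<in> regular_normal_cone \<Omega> x"
  unfolding regular_normal_cone_iff
proof (intro conjI allI impI)
  fix \<epsilon> :: real
  assume \<epsilon>: "0 < \<epsilon>"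
  show "\<exists>d>0. \<forall>x'\<in>\<Omega>. norm (x' - x) < d \<longrightarrow> inner \<xi> (x' - x) \<le> \<epsilon> * norm (x' - x)"
  proof (intro exI[of _ "min d (\<epsilon> / (c + 1))"] conjI ballI impI)
    show "0 < min d (\<epsilon> / (c + 1))"
      using assms \<epsilon> by simp
    fix x'
    assume x': "x' \<in> \<Omega>" "norm (x' - x) < min d (\<epsilon> / (c + 1))"
    then have "(c + 1) * norm (x' - x) \<le> \<epsilon>"
      using assms(3) by (simp add: field_simps)
    then have "c * norm (x' - x) \<le> \<epsilon>"
      using norm_ge_zero[of "x' - x"] by (simp only: distrib_right)
    then have "c * norm (x' - x) * norm (x' - x) \<le> \<epsilon> * norm (x' - x)"
      by (rule mult_right_mono) simp
    then show "inner \<xi> (x' - x) \<le> \<epsilon> * norm (x' - x)"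
      using prox[of x'] x' by (simp add: power2_eq_square mult.assoc)
  qed
qed (fact assms(1))

text \<open>Moving only the real variable changes both copies of it by the same amount, so the graph contains a line
  in this direction, to which every normal is orthogonal; fixing the real variable leaves the graph of \<open>\<phi>\<close>.\<close>

lemma regular_normal_gph_times_id:
  fixes \<phi> :: "'a::real_inner \<Rightarrow> 'b::real_inner" and a b c :: real
  assumes "((\<xi>, b), (\<eta>, c)) \<in>
    regular_normal_cone (gph (\<lambda>z. (\<phi> (fst z), snd z))) ((x, a), (\<phi> x, a))"
  shows "(\<xi>, \<eta>) \<in> regular_normal_cone (gph \<phi>) (x, \<phi> x)" and "b + c = 0"
proof -
  let ?q = "\<lambda>z::'a \<times> real. (\<phi> (fst z), snd z)"
  have reg: "\<exists>d>0. \<forall>x' a'. norm (((x', a'), (\<phi> x', a')) - ((x, a), (\<phi> x, a))) < d \<longrightarrow>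
      inner \<xi> (x' - x) + b * (a' - a) + (inner \<eta> (\<phi> x' - \<phi> x) + c * (a' - a))
        \<le> \<epsilon> * norm (((x', a'), (\<phi> x', a')) - ((x, a), (\<phi> x, a)))" if "\<epsilon> > 0" for \<epsilon>
  proof -
    note * = assms[unfolded regular_normal_cone_iff, THEN conjunct2, rule_format, OF that]
    obtain d where "d > 0" and d: "\<forall>p\<in>gph ?q. norm (p - ((x, a), (\<phi> x, a))) < d \<longrightarrow>
       inner ((\<xi>, b), (\<eta>, c)) (p - ((x, a), (\<phi> x, a))) \<le> \<epsilon> * norm (p - ((x, a), (\<phi> x, a)))"
      using * by (elim exE conjE)
    show ?thesis
    proof (intro exI[of _ d] conjI allI impI)
      fix x' a'
      assume n: "norm (((x', a'), (\<phi> x', a')) - ((x, a), (\<phi> x, a))) < d"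
      have "((x', a'), (\<phi> x', a')) \<in> gph ?q"
        unfolding gph_def by force
      then have "inner ((\<xi>, b), (\<eta>, c)) (((x', a'), (\<phi> x', a')) - ((x, a), (\<phi> x, a)))
          \<le> \<epsilon> * norm (((x', a'), (\<phi> x', a')) - ((x, a), (\<phi> x, a)))"
        using d n by blast
      then show "inner \<xi> (x' - x) + b * (a' - a) + (inner \<eta> (\<phi> x' - \<phi> x) + c * (a' - a))
          \<le> \<epsilon> * norm (((x', a'), (\<phi> x', a')) - ((x, a), (\<phi> x, a)))"
        by (simp only: diff_Pair inner_Pair inner_real_def)
    qed (fact \<open>d > 0\<close>)
  qed
  show "(\<xi>, \<eta>) \<in> regular_normal_cone (gph \<phi>) (x, \<phi> x)"
    unfolding regular_normal_cone_iff
  proof (intro conjI allI impI)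
    show "(x, \<phi> x) \<in> gph \<phi>"
      unfolding gph_def by blast
    fix \<epsilon> :: real
    assume "0 < \<epsilon>"
    from reg[OF this] obtain d where "d > 0"
      and d: "\<And>x'. norm (((x', a), (\<phi> x', a)) - ((x, a), (\<phi> x, a))) < d \<Longrightarrow>
      inner \<xi> (x' - x) + inner \<eta> (\<phi> x' - \<phi> x)
        \<le> \<epsilon> * norm (((x', a), (\<phi> x', a)) - ((x, a), (\<phi> x, a)))"
      by (metis add.right_neutral diff_self mult_zero_right)
    have "norm (((x', a), (\<phi> x', a)) - ((x, a), (\<phi> x, a))) = norm ((x', \<phi> x') - (x, \<phi> x))" for x'
      by (simp add: norm_Pair)
    with d have "inner (\<xi>, \<eta>) (p - (x, \<phi> x)) \<le> \<epsilon> * norm (p - (x, \<phi> x))"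
      if "p \<in> gph \<phi>" "norm (p - (x, \<phi> x)) < d" for p
      using that unfolding gph_def by (auto simp: inner_Pair)
    then show "\<exists>d>0. \<forall>p\<in>gph \<phi>. norm (p - (x, \<phi> x)) < d \<longrightarrow>
        inner (\<xi>, \<eta>) (p - (x, \<phi> x)) \<le> \<epsilon> * norm (p - (x, \<phi> x))"
      using \<open>d > 0\<close> by blast
  qed
  have le: "\<bar>b + c\<bar> \<le> \<epsilon> * sqrt 2" if "\<epsilon> > 0" for \<epsilon>
  proof -
    from reg[OF that] obtain d where "d > 0"
      and d: "\<And>a'. norm (((x, a'), (\<phi> x, a')) - ((x, a), (\<phi> x, a))) < d \<Longrightarrow>
      b * (a' - a) + c * (a' - a) \<le> \<epsilon> * norm (((x, a'), (\<phi> x, a')) - ((x, a), (\<phi> x, a)))"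
      by (metis add.left_neutral diff_self inner_zero_right)
    have n: "norm (((x, a'), (\<phi> x, a')) - ((x, a), (\<phi> x, a))) = sqrt 2 * \<bar>a' - a\<bar>" for a'
      by (simp add: norm_Pair real_sqrt_mult flip: mult_2)
    define e where "e = d / 2"
    have e: "e > 0" "sqrt 2 * e < d"
      using \<open>d > 0\<close> real_less_lsqrt[of 2 2] by (auto simp: e_def)
    have "(b + c) * e \<le> \<epsilon> * sqrt 2 * e" "- (b + c) * e \<le> \<epsilon> * sqrt 2 * e"
      using d[of "a + e"] d[of "a - e"] e unfolding n by (auto simp: algebra_simps)
    then show ?thesis
      using e(1) by (simp only: mult_le_cancel_right) auto
  qed
  have "\<bar>b + c\<bar> \<le> 0"
  proof (rule field_le_epsilon)
    fix \<epsilon> :: real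
    assume "0 < \<epsilon>"
    then show "\<bar>b + c\<bar> \<le> 0 + \<epsilon>"
      using le[of "\<epsilon> / sqrt 2"] by simp
  qed
  then show "b + c = 0"
    by simp
qed

text \<open>Above the graph one may move down inside the epigraph, in a direction with which \<open>(\<xi>, - \<beta>)\<close> has a
  positive inner product.\<close>

lemma regular_normal_epi_on_graph:
  fixes f :: "'a::real_inner \<Rightarrow> ereal"
  assumes "(\<xi>, - \<beta>) \<in> regular_normal_cone (epi f) (x, a)" "\<beta> > 0"
  shows "f x = ereal a"
proof (rule ccontr)
  assume ne: "f x \<noteq> ereal a"
  have "f x \<le> ereal a"
    using assms(1) unfolding regular_normal_cone_iff epi_def by auto
  with ne have "f x < ereal a"
    by simp
  then obtain b where b: "f x \<le> ereal b" "b < a"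
    by (metis ereal_dense2 less_ereal.simps(1) less_imp_le)
  obtain d where "d > 0" and d: "\<forall>p\<in>epi f. norm (p - (x, a)) < d \<longrightarrow>
       inner (\<xi>, - \<beta>) (p - (x, a)) \<le> (\<beta> / 2) * norm (p - (x, a))"
    using assms unfolding regular_normal_cone_iff by (meson half_gt_zero)
  define e where "e = min (a - b) (d / 2)"
  have e: "e > 0" "e < d" "b \<le> a - e"
    using b \<open>d > 0\<close> by (auto simp: e_def)
  have "(x, a - e) \<in> epi f"
    using b(1) e(3) unfolding epi_def by (auto intro: order_trans)
  with d e have "\<beta> * e \<le> (\<beta> / 2) * e"
    by (fastforce simp: norm_Pair inner_Pair)
  then show False
    using assms(2) e(1) by simp
qed

section \<open>A fuzzy preimage rule\<close>

text \<open>For \<open>s > 0\<close> this is the norm, made smooth at the origin: it exceeds the norm by at most \<open>s\<close>, is Lipschitz with constant \<open>1\<close>,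
  and has gradient \<open>w /\<^sub>R soft_norm s w\<close>.\<close>

definition soft_norm :: "real \<Rightarrow> 'a::real_inner \<Rightarrow> real" where
  "soft_norm s w = sqrt (s\<^sup>2 + (norm w)\<^sup>2)"

lemma norm_le_soft_norm: "norm w \<le> soft_norm s w"
  unfolding soft_norm_def by (rule real_le_rsqrt) simp

lemma le_soft_norm: "s \<le> soft_norm s w"
  unfolding soft_norm_def by (rule real_le_rsqrt) simp

lemma soft_norm_0 [simp]: "s \<ge> 0 \<Longrightarrow> soft_norm s 0 = s"
  by (simp add: soft_norm_def)

lemma continuous_on_soft_norm [continuous_intros]:
  "continuous_on A k \<Longrightarrow> continuous_on A (\<lambda>x. soft_norm s (k x))"
  unfolding soft_norm_def by (intro continuous_intros)

lemma norm_soft_norm_gradient_le: "s > 0 \<Longrightarrow> norm (w /\<^sub>R soft_norm s w) \<le> 1"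
  using norm_le_soft_norm[of w s] le_soft_norm[of s w] by (simp add: field_simps)

text \<open>The square root is concave, hence lies below its tangent. This replaces differentiation: a minimizer of a
  combination of such functions satisfies a proximal normal inequality directly.\<close>

lemma soft_norm_quadratic_upper_bound:
  assumes "s > 0"
  shows "soft_norm s w' - soft_norm s w \<le>
     inner (w /\<^sub>R soft_norm s w) (w' - w) + (norm (w' - w))\<^sup>2 / (2 * s)"
proof -
  define N N' where "N = soft_norm s w" and "N' = soft_norm s w'"
  have N: "N > 0" "N \<ge> s"
    using le_soft_norm[of s w] assms by (auto simp: N_def)
  have sq: "N\<^sup>2 = s\<^sup>2 + inner w w" "N'\<^sup>2 = s\<^sup>2 + inner w' w'"
    by (simp_all add: N_def N'_def soft_norm_def power2_norm_eq_inner)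
  have "2 * N * (N' - N) \<le> N'\<^sup>2 - N\<^sup>2"
    using zero_le_power2[of "N' - N"] by (simp add: power2_eq_square algebra_simps)
  also have "\<dots> = 2 * inner w (w' - w) + (norm (w' - w))\<^sup>2"
    unfolding sq power2_norm_eq_inner by (simp add: inner_diff algebra_simps inner_commute)
  finally have "N' - N \<le> inner w (w' - w) / N + (norm (w' - w))\<^sup>2 / (2 * N)"
    using N(1) by (simp add: field_simps)
  moreover have "(norm (w' - w))\<^sup>2 / (2 * N) \<le> (norm (w' - w))\<^sup>2 / (2 * s)"
    using N assms by (intro divide_left_mono) auto
  moreover have "inner (w /\<^sub>R N) (w' - w) = inner w (w' - w) / N"
    by (simp add: divide_inverse mult.commute)
  ultimately have "N' - N \<le> inner (w /\<^sub>R N) (w' - w) + (norm (w' - w))\<^sup>2 / (2 * s)"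
    by linarith
  then show ?thesis
    unfolding N_def N'_def .
qed

text \<open>Exact penalization: the linear function \<open>\<zeta>\<close> minus \<open>\<epsilon> * norm\<close> has a local maximum on \<open>C\<close> at \<open>z0\<close> and is
  Lipschitz with constant \<open>norm \<zeta> + \<epsilon>\<close>, so off \<open>C\<close> it exceeds its maximum at most by that constant times the distance to \<open>C\<close>.\<close>

lemma penalty_of_regular_normal:
  fixes q :: "'a::real_inner \<Rightarrow> 'b::real_normed_vector"
  assumes norm: "\<zeta> \<in> regular_normal_cone C z0" and "\<kappa> > 0" "r > 0" "\<epsilon> > 0"
    and sub: "\<And>z p. z \<in> ball z0 r \<Longrightarrow> p \<in> E \<Longrightarrow> edist_set C z \<le> ereal (\<kappa> * norm (q z - p))"
  obtains d where "d > 0"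
    "\<And>z p. norm (z - z0) < d \<Longrightarrow> p \<in> E \<Longrightarrow>
       inner \<zeta> (z - z0) \<le> \<epsilon> * norm (z - z0) + (norm \<zeta> + \<epsilon>) * \<kappa> * norm (q z - p)"
proof -
  obtain d where "d > 0"
    and d: "\<And>z. z \<in> C \<Longrightarrow> norm (z - z0) < d \<Longrightarrow> inner \<zeta> (z - z0) \<le> \<epsilon> * norm (z - z0)"
    using norm \<open>\<epsilon> > 0\<close> unfolding regular_normal_cone_iff by blast
  show thesis
  proof
    show "min r (d / 2) > 0"
      using assms \<open>d > 0\<close> by simp
    fix z p
    assume z: "norm (z - z0) < min r (d / 2)" and p: "p \<in> E"
    define D where "D = \<kappa> * norm (q z - p)"
    have "D \<ge> 0"
      using \<open>\<kappa> > 0\<close> by (simp add: D_def)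
    have "inner \<zeta> (z - z0) \<le> \<epsilon> * norm (z - z0) + (norm \<zeta> + \<epsilon>) * D"
    \<comment> \<open>If \<open>D\<close> is large, the point \<open>z0\<close> of \<open>C\<close> is already close enough to \<open>z\<close>; otherwise a point of \<open>C\<close> at
      distance less than \<open>norm (z - z0)\<close> from \<open>z\<close> is still in the range where \<open>d\<close> applies.\<close>
    proof (cases "D \<ge> norm (z - z0)")
      case True
      have "inner \<zeta> (z - z0) \<le> norm \<zeta> * norm (z - z0)"
        by (rule norm_cauchy_schwarz)
      also have "\<dots> \<le> norm \<zeta> * D"
        using True by (rule mult_left_mono) simp
      also have "\<dots> \<le> \<epsilon> * norm (z - z0) + (norm \<zeta> + \<epsilon>) * D"
        using \<open>\<epsilon> > 0\<close> \<open>D \<ge> 0\<close> by (simp add: algebra_simps)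
      finally show ?thesis .
    next
      case False
      have "inner \<zeta> (z - z0) \<le> \<epsilon> * norm (z - z0) + (norm \<zeta> + \<epsilon>) * D'"
        if "D < D'" "D' < norm (z - z0)" for D'
      proof -
        have "edist_set C z < ereal D'"
          using sub[of z p] z p that by (simp add: D_def dist_norm norm_minus_commute order.strict_trans1)
        then obtain y where y: "y \<in> C" "dist z y < D'"
          unfolding edist_set_def by (auto simp: INF_less_iff)
        have tri: "norm (y - z0) \<le> norm (z - z0) + norm (z - y)"
          by norm
        have "inner \<zeta> (z - z0) = inner \<zeta> (y - z0) + inner \<zeta> (z - y)"
          by (simp add: inner_diff)
        also have "inner \<zeta> (y - z0) \<le> \<epsilon> * norm (y - z0)"
          using d[OF y(1)] tri y(2) that z by (simp add: dist_norm)
        also have "\<dots> \<le> \<epsilon> * (norm (z - z0) + norm (z - y))"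
          using tri \<open>\<epsilon> > 0\<close> by simp
        also have "inner \<zeta> (z - y) \<le> norm \<zeta> * norm (z - y)"
          by (rule norm_cauchy_schwarz)
        finally have "inner \<zeta> (z - z0) \<le> \<epsilon> * norm (z - z0) + (norm \<zeta> + \<epsilon>) * norm (z - y)"
          by (simp add: algebra_simps)
        also have "\<dots> \<le> \<epsilon> * norm (z - z0) + (norm \<zeta> + \<epsilon>) * D'"
          using y(2) \<open>\<epsilon> > 0\<close> by (intro add_left_mono mult_left_mono) (auto simp: dist_norm)
        finally show ?thesis .
      qed
      then have "\<forall>\<^sub>F D' in at_right D. inner \<zeta> (z - z0) \<le> \<epsilon> * norm (z - z0) + (norm \<zeta> + \<epsilon>) * D'"
        using False unfolding eventually_at_right_field by (meson not_le)
      moreover have "((\<lambda>D'. \<epsilon> * norm (z - z0) + (norm \<zeta> + \<epsilon>) * D') \<longlongrightarrow>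
          \<epsilon> * norm (z - z0) + (norm \<zeta> + \<epsilon>) * D) (at_right D)"
        by (intro tendsto_intros)
      ultimately show ?thesis
        by (intro tendsto_lowerbound) auto
    qed
    then show "inner \<zeta> (z - z0) \<le> \<epsilon> * norm (z - z0) + (norm \<zeta> + \<epsilon>) * \<kappa> * norm (q z - p)"
      by (simp add: D_def mult.assoc)
  qed
qed

text \<open>Of the two \<open>\<epsilon>\<close> in the factor \<open>2 * \<epsilon>\<close> of the minimized function, one cancels the error in the penalty
  inequality and the other one forces the minimizer towards \<open>z0\<close> as \<open>s\<close> tends to \<open>0\<close>. The
  smoothed term in \<open>z - z0\<close> has gradient \<open>e\<close>; the one in \<open>q z - p\<close> has opposite gradients in \<open>q z\<close> and in \<open>p\<close>,
  which is why the same \<open>\<eta>\<close> appears in both normals.\<close>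

lemma fuzzy_normals_of_penalty:
  fixes q :: "'a::euclidean_space \<Rightarrow> 'b::euclidean_space"
  assumes q: "continuous_on UNIV q" and E: "closed E" "q z0 \<in> E"
    and pos: "\<epsilon> > 0" "L > 0" "r > 0" "\<tau> > 0"
    and pen: "\<And>z p. norm (z - z0) < r \<Longrightarrow> p \<in> E \<Longrightarrow>
       inner \<zeta> (z - z0) \<le> \<epsilon> * norm (z - z0) + L * norm (q z - p)"
  obtains z p e \<eta> where
    "norm (z - z0) < \<tau>" "norm (q z - q z0) < \<tau>" "norm (p - q z0) < \<tau>"
    "norm e \<le> 2 * \<epsilon>" "norm \<eta> \<le> L"
    "(\<zeta> - e, - \<eta>) \<in> regular_normal_cone (gph q) (z, q z)"
    "\<eta> \<in> regular_normal_cone E p"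
proof -
  define \<tau>' where "\<tau>' = min \<tau> 1"
  have \<tau>': "\<tau>' > 0" "\<tau>' \<le> \<tau>" "\<tau>' \<le> 1"
    using pos by (auto simp: \<tau>'_def)
  obtain d0 where d0: "d0 > 0" "\<And>z. norm (z - z0) < d0 \<Longrightarrow> norm (q z - q z0) < \<tau>' / 2"
    using q \<tau>'(1) unfolding continuous_on_iff dist_norm by (metis UNIV_I half_gt_zero)
  \<comment> \<open>The last bound controls \<open>norm (q z - p)\<close>, and \<open>s\<close> is so small that the value at the centre,
    \<open>(2 * \<epsilon> + L) * s\<close>, keeps the minimizer off the boundaries of the two balls in \<open>K\<close>.\<close>
  define \<delta> where "\<delta> = Min {d0, r / 2, \<tau>', L * \<tau>' / (4 * (\<epsilon> + norm \<zeta>))}"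
  have en: "\<epsilon> + norm \<zeta> > 0"
    using pos norm_ge_zero[of \<zeta>] by linarith
  have \<delta>: "\<delta> > 0" "\<delta> \<le> d0" "\<delta> < r" "\<delta> \<le> \<tau>'"
    using d0(1) pos \<tau>'(1) en by (auto simp: \<delta>_def min_less_iff_disj)
  have "\<delta> \<le> L * \<tau>' / (4 * (\<epsilon> + norm \<zeta>))"
    by (simp add: \<delta>_def)
  then have \<delta>L: "(\<epsilon> + norm \<zeta>) * \<delta> \<le> L * \<tau>' / 4"
    using en by (simp add: field_simps)
  define s where "s = \<epsilon> * \<delta> / (4 * (2 * \<epsilon> + L))"
  have s: "s > 0" "(2 * \<epsilon> + L) * s = \<epsilon> * \<delta> / 4"
    using pos \<delta>(1) add_pos_pos[of "2 * \<epsilon>" L] by (auto simp: s_def simp del: distrib_left_numeral)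
  define \<Theta> where "\<Theta> z p = - inner \<zeta> (z - z0) + 2 * \<epsilon> * soft_norm s (z - z0)
      + L * soft_norm s (q z - p)" for z p
  define K where "K = cball z0 \<delta> \<times> (E \<inter> cball (q z0) 1)"
  have "compact K"
    unfolding K_def using E(1) by (intro compact_Times closed_Int_compact) auto
  moreover have K0: "(z0, q z0) \<in> K"
    unfolding K_def using E(2) \<delta>(1) by simp
  moreover have "continuous_on K (\<lambda>w. \<Theta> (fst w) (snd w))"
    unfolding \<Theta>_def
    by (intro continuous_intros continuous_on_compose2[OF q]) auto
  ultimately obtain w where "w \<in> K" "\<And>w'. w' \<in> K \<Longrightarrow> \<Theta> (fst w) (snd w) \<le> \<Theta> (fst w') (snd w')"
    using continuous_attains_inf[of K "\<lambda>w. \<Theta> (fst w) (snd w)"] by blast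
  then obtain z p where zp: "(z, p) \<in> K"
    and minim: "\<And>z' p'. (z', p') \<in> K \<Longrightarrow> \<Theta> z p \<le> \<Theta> z' p'"
    by (cases w) fastforce
  have pE: "p \<in> E" and zr: "norm (z - z0) < r"
    using zp \<delta>(3) by (auto simp: K_def dist_norm norm_minus_commute)
  have "- inner \<zeta> (z - z0) + 2 * \<epsilon> * norm (z - z0) + L * norm (q z - p) \<le> \<Theta> z p"
    unfolding \<Theta>_def using pos by (intro add_mono mult_left_mono norm_le_soft_norm) auto
  also have "\<Theta> z p \<le> \<Theta> z0 (q z0)"
    by (rule minim[OF K0])
  also have "\<dots> = \<epsilon> * \<delta> / 4"
    using s by (simp add: \<Theta>_def algebra_simps)
  finally have up: "- inner \<zeta> (z - z0) + 2 * \<epsilon> * norm (z - z0) + L * norm (q z - p) \<le> \<epsilon> * \<delta> / 4" .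
  with pen[OF zr pE] have "\<epsilon> * norm (z - z0) \<le> \<epsilon> * (\<delta> / 4)"
    by simp
  then have zd: "norm (z - z0) \<le> \<delta> / 4"
    using pos(1) by simp
  have "L * norm (q z - p) \<le> \<epsilon> * \<delta> / 4 + inner \<zeta> (z - z0)"
  proof -
    have "0 \<le> 2 * \<epsilon> * norm (z - z0)"
      using pos(1) by simp
    with up show ?thesis
      by linarith
  qed
  also have "\<dots> \<le> \<epsilon> * \<delta> / 4 + norm \<zeta> * norm (z - z0)"
    by (simp add: norm_cauchy_schwarz)
  also have "\<dots> \<le> \<epsilon> * \<delta> / 4 + norm \<zeta> * (\<delta> / 4)"
    using zd by (intro add_left_mono mult_left_mono) auto
  also have "\<dots> = (\<epsilon> + norm \<zeta>) * \<delta> / 4"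
    by (simp add: algebra_simps)
  also have "\<dots> \<le> L * (\<tau>' / 16)"
    using \<delta>L by (simp add: field_simps)
  finally have qp: "norm (q z - p) \<le> \<tau>' / 16"
    using pos(2) by simp
  have qz: "norm (q z - q z0) < \<tau>' / 2"
    using zd \<delta> by (intro d0(2)) auto
  have "norm (p - q z0) \<le> norm (q z - p) + norm (q z - q z0)"
    by norm
  with qp qz \<tau>'(1) have p1: "norm (p - q z0) < 3/4 * \<tau>'"
    by simp

  define Gz where "Gz = (z - z0) /\<^sub>R soft_norm s (z - z0)"
  define Gq where "Gq = (q z - p) /\<^sub>R soft_norm s (q z - p)"
  define e where "e = (2 * \<epsilon>) *\<^sub>R Gz"
  define \<eta> where "\<eta> = L *\<^sub>R Gq"
  show thesis
  proof
    show "norm (z - z0) < \<tau>" "norm (q z - q z0) < \<tau>" "norm (p - q z0) < \<tau>"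
      using zd \<delta> \<tau>' qz p1 by auto
    show "norm e \<le> 2 * \<epsilon>"
      using norm_soft_norm_gradient_le[OF s(1), of "z - z0"] pos(1)
      by (simp add: e_def flip: Gz_def)
    show "norm \<eta> \<le> L"
      using norm_soft_norm_gradient_le[OF s(1), of "q z - p"] pos(2)
      by (simp add: \<eta>_def flip: Gq_def)
    show "(\<zeta> - e, - \<eta>) \<in> regular_normal_cone (gph q) (z, q z)"
    proof (rule proximal_imp_regular_normal)
      show "(z, q z) \<in> gph q"
        unfolding gph_def by blast
      show "\<delta> / 2 > 0" "(2 * \<epsilon> + L) / (2 * s) \<ge> 0"
        using \<delta> s pos by auto
      fix w
      assume "w \<in> gph q" and w: "norm (w - (z, q z)) < \<delta> / 2"
      then obtain z' where z': "w = (z', q z')"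
        unfolding gph_def by blast
      define n where "n = norm (w - (z, q z))"
      have n: "norm (z' - z) \<le> n" "norm (q z' - q z) \<le> n"
        unfolding n_def z' using norm_fst_le[of "(z' - z)" "q z' - q z"] norm_snd_le[of "q z' - q z" "(z' - z)"]
        by auto
      have "norm (z' - z0) \<le> norm (z' - z) + norm (z - z0)"
        by norm
      then have "norm (z' - z0) \<le> \<delta>"
        using n(1) w zd \<delta>(1) unfolding n_def by linarith
      then have "(z', p) \<in> K"
        using zp by (auto simp: K_def dist_norm norm_minus_commute)
      then have "0 \<le> \<Theta> z' p - \<Theta> z p"
        using minim by simp
      also have "\<dots> = - inner \<zeta> (z' - z) + 2 * \<epsilon> * (soft_norm s (z' - z0) - soft_norm s (z - z0))
          + L * (soft_norm s (q z' - p) - soft_norm s (q z - p))"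
        by (simp add: \<Theta>_def inner_diff algebra_simps)
      also have "\<dots> \<le> - inner \<zeta> (z' - z)
          + 2 * \<epsilon> * (inner Gz (z' - z) + n\<^sup>2 / (2 * s))
          + L * (inner Gq (q z' - q z) + n\<^sup>2 / (2 * s))"
      proof (intro add_mono mult_left_mono order_refl)
        show "soft_norm s (z' - z0) - soft_norm s (z - z0)
            \<le> inner Gz (z' - z) + n\<^sup>2 / (2 * s)"
          using soft_norm_quadratic_upper_bound[OF s(1), of "z' - z0" "z - z0"]
            divide_right_mono[OF power_mono[OF n(1), of 2], of "2 * s"] s(1)
          unfolding Gz_def Gq_def by simp
        show "soft_norm s (q z' - p) - soft_norm s (q z - p)
            \<le> inner Gq (q z' - q z) + n\<^sup>2 / (2 * s)"
          using soft_norm_quadratic_upper_bound[OF s(1), of "q z' - p" "q z - p"]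
            divide_right_mono[OF power_mono[OF n(2), of 2], of "2 * s"] s(1)
          unfolding Gz_def Gq_def by simp
      qed (use pos in auto)
      also have "\<dots> = - inner (\<zeta> - e, - \<eta>) (w - (z, q z)) + (2 * \<epsilon> + L) / (2 * s) * n\<^sup>2"
        using s(1) by (simp add: e_def \<eta>_def z' inner_Pair inner_diff_left add_divide_distrib algebra_simps)
      finally show "inner (\<zeta> - e, - \<eta>) (w - (z, q z)) \<le> (2 * \<epsilon> + L) / (2 * s) * (norm (w - (z, q z)))\<^sup>2"
        by (simp add: n_def)
    qed
    show "\<eta> \<in> regular_normal_cone E p"
    proof (rule proximal_imp_regular_normal[OF pE])
      show "\<tau>' / 4 > 0" "L / (2 * s) \<ge> 0"
        using \<tau>' s pos by auto
      fix p'
      assume p': "p' \<in> E" "norm (p' - p) < \<tau>' / 4"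
      have "norm (p' - q z0) \<le> norm (p' - p) + norm (p - q z0)"
        by norm
      then have "norm (p' - q z0) \<le> 1"
        using p'(2) p1 \<tau>'(3) by linarith
      then have "(z, p') \<in> K"
        using zp p'(1) by (auto simp: K_def dist_norm norm_minus_commute)
      then have "0 \<le> \<Theta> z p' - \<Theta> z p"
        using minim by simp
      also have "\<dots> = L * (soft_norm s (q z - p') - soft_norm s (q z - p))"
        by (simp add: \<Theta>_def algebra_simps)
      also have "\<dots> \<le> L * (inner Gq (p - p') + (norm (p' - p))\<^sup>2 / (2 * s))"
        using soft_norm_quadratic_upper_bound[OF s(1), of "q z - p'" "q z - p"] pos(2)
        unfolding Gq_def by (intro mult_left_mono) (auto simp: norm_minus_commute)
      also have "\<dots> = - inner \<eta> (p' - p) + L / (2 * s) * (norm (p' - p))\<^sup>2"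
        using s(1) by (simp add: \<eta>_def inner_diff_right algebra_simps)
      finally show "inner \<eta> (p' - p) \<le> L / (2 * s) * (norm (p' - p))\<^sup>2"
        by simp
    qed
  qed
qed


lemma closed_epi:
  fixes g :: "'a::metric_space \<Rightarrow> ereal"
  assumes "lower_semicontinuous g"
  shows "closed (epi g)"
  unfolding closed_sequential_limits
proof (intro allI impI, elim conjE)
  fix w :: "nat \<Rightarrow> 'a \<times> real" and l
  assume w: "\<forall>n. w n \<in> epi g" "w \<longlonglongrightarrow> l"
  obtain x a where l: "l = (x, a)"
    by fastforce
  have x: "(\<lambda>n. fst (w n)) \<longlonglongrightarrow> x" and a: "(\<lambda>n. snd (w n)) \<longlonglongrightarrow> a"
    using tendsto_fst[OF w(2)] tendsto_snd[OF w(2)] by (simp_all add: l)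
  have "g x \<le> ereal a"
  proof (rule ccontr)
    assume "\<not> g x \<le> ereal a"
    then obtain c where c: "a < c" "ereal c < g x"
      using ereal_dense2[of "ereal a" "g x"] by (auto simp: not_le)
    have "ereal c < Liminf (at x) g"
      using assms c(2) unfolding lower_semicontinuous_def by (meson less_le_trans)
    then have "\<forall>\<^sub>F y in at x. ereal c < g y"
      by (rule less_LiminfD)
    then have "\<forall>\<^sub>F y in nhds x. ereal c < g y"
      unfolding eventually_at_filter by (rule eventually_mono) (use c(2) in auto)
    with x have "\<forall>\<^sub>F n in sequentially. ereal c < g (fst (w n))"
      unfolding filterlim_iff by blast
    moreover have "\<forall>\<^sub>F n in sequentially. snd (w n) < c"
      using a c(1) by (rule order_tendstoD(2))
    ultimately have "\<forall>\<^sub>F n in sequentially. False"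
    proof eventually_elim
      case (elim n)
      have "g (fst (w n)) \<le> ereal (snd (w n))"
        using w(1)[rule_format, of n] by (auto simp: epi_def split: prod.splits)
      also have "\<dots> < ereal c"
        using elim by simp
      finally show ?case
        using elim by simp
    qed
    then show False
      by simp
  qed
  then show "l \<in> epi g"
    by (simp add: epi_def l)
qed

lemma fuzzy_normals_of_composite:
  fixes \<phi> :: "'a::euclidean_space \<Rightarrow> 'b::euclidean_space"
  assumes \<phi>: "continuous_on UNIV \<phi>" and g: "lower_semicontinuous g"
    and reg: "(\<xi>, - \<beta>) \<in> regular_normal_cone (epi (g \<circ> \<phi>)) (x, a)"
    and pos: "\<kappa> > 0" "r > 0" "\<epsilon> > 0" "\<tau> > 0"
    and sub: "\<And>z p. z \<in> ball (x, a) r \<Longrightarrow> p \<in> epi g \<Longrightarrow>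
      edist_set (epi (g \<circ> \<phi>)) z \<le> ereal (\<kappa> * norm ((\<phi> (fst z), snd z) - p))"
  obtains x' p \<xi>' \<eta> \<beta>' where
    "norm (x' - x) < \<tau>" "norm (\<phi> x' - \<phi> x) < \<tau>" "norm (p - (\<phi> x, a)) < \<tau>"
    "norm (\<xi>' - \<xi>) \<le> 2 * \<epsilon>" "\<bar>\<beta>' - \<beta>\<bar> \<le> 2 * \<epsilon>" "norm \<eta> \<le> (norm (\<xi>, - \<beta>) + \<epsilon>) * \<kappa>"
    "(\<xi>', - \<eta>) \<in> regular_normal_cone (gph \<phi>) (x', \<phi> x')"
    "(\<eta>, - \<beta>') \<in> regular_normal_cone (epi g) p"
proof -
  let ?q = "\<lambda>z::'a \<times> real. (\<phi> (fst z), snd z)"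
  let ?L = "(norm (\<xi>, - \<beta>) + \<epsilon>) * \<kappa>"
  have q: "continuous_on UNIV ?q"
    by (intro continuous_intros continuous_on_compose2[OF \<phi>]) auto
  have E: "?q (x, a) \<in> epi g"
    using reg unfolding regular_normal_cone_iff epi_def by auto
  have L: "?L > 0"
    using pos by (intro mult_pos_pos add_nonneg_pos) auto
  obtain d where d: "d > 0" "\<And>z p. norm (z - (x, a)) < d \<Longrightarrow> p \<in> epi g \<Longrightarrow>
      inner (\<xi>, - \<beta>) (z - (x, a)) \<le> \<epsilon> * norm (z - (x, a)) + ?L * norm (?q z - p)"
    using penalty_of_regular_normal[OF reg pos(1-3), of "epi g" ?q] sub by blast
  obtain z p e \<eta> where
    *: "norm (z - (x, a)) < \<tau>" "norm (?q z - ?q (x, a)) < \<tau>" "norm (p - ?q (x, a)) < \<tau>"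
    "norm e \<le> 2 * \<epsilon>" "norm \<eta> \<le> ?L"
    "((\<xi>, - \<beta>) - e, - \<eta>) \<in> regular_normal_cone (gph ?q) (z, ?q z)"
    "\<eta> \<in> regular_normal_cone (epi g) p"
    by (rule fuzzy_normals_of_penalty[OF q closed_epi[OF g] E pos(3) L d(1) pos(4) d(2)])
  obtain x' a' where z: "z = (x', a')"
    by fastforce
  obtain e1 e2 where e: "e = (e1, e2)"
    by fastforce
  obtain \<eta>1 \<eta>2 where \<eta>: "\<eta> = (\<eta>1, \<eta>2)"
    by fastforce
  have n: "((\<xi> - e1, - \<beta> - e2), (- \<eta>1, - \<eta>2)) \<in> regular_normal_cone (gph ?q) ((x', a'), (\<phi> x', a'))"
    using *(6) by (simp add: z e \<eta>)
  have \<eta>2: "\<eta>2 = - (\<beta> + e2)"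
    using regular_normal_gph_times_id(2)[OF n] by simp
  show thesis
  proof
    show "norm (x' - x) < \<tau>"
      using *(1) norm_fst_le[of "x' - x" "a' - a"] by (simp add: z)
    show "norm (\<phi> x' - \<phi> x) < \<tau>"
      using *(2) norm_fst_le[of "\<phi> x' - \<phi> x" "a' - a"] by (simp add: z)
    show "norm (p - (\<phi> x, a)) < \<tau>"
      using *(3) by simp
    show "norm ((\<xi> - e1) - \<xi>) \<le> 2 * \<epsilon>"
      using *(4) norm_fst_le[of e1 e2] by (simp add: e)
    show "\<bar>(\<beta> + e2) - \<beta>\<bar> \<le> 2 * \<epsilon>"
      using *(4) norm_snd_le[of e2 e1] by (simp add: e)
    show "norm \<eta>1 \<le> ?L"
      using *(5) norm_fst_le[of \<eta>1 \<eta>2] by (simp add: \<eta>)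
    show "(\<xi> - e1, - \<eta>1) \<in> regular_normal_cone (gph \<phi>) (x', \<phi> x')"
      by (rule regular_normal_gph_times_id(1)[OF n])
    show "(\<eta>1, - (\<beta> + e2)) \<in> regular_normal_cone (epi g) p"
      using *(7) by (simp add: \<eta> \<eta>2)
  qed
qed

section \<open>Passage to the limit\<close>

text \<open>A basic directional neighbourhood of \<open>u \<noteq> 0\<close> contains an open cone around the ray of \<open>u\<close>, cut off at
  \<open>\<rho>\<close>; the one of \<open>0\<close> is a full ball.\<close>

lemma dir_nbhd_absorbs:
  fixes us :: "nat \<Rightarrow> 'a::real_normed_vector"
  assumes "dir_nbhd u U" and t: "\<And>k. t k > 0" "t \<longlonglongrightarrow> 0" and us: "us \<longlonglongrightarrow> u"
  shows "\<forall>\<^sub>F k in sequentially. \<exists>r>0. ball (t k *\<^sub>R us k) r \<subseteq> U"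
proof -
  obtain \<rho> \<delta> where pos: "\<rho> > 0" "\<delta> > 0" and U: "dir_nbhd_basic \<rho> \<delta> u \<subseteq> U"
    using assms(1) unfolding dir_nbhd_def by blast
  have "(\<lambda>k. t k *\<^sub>R us k) \<longlonglongrightarrow> 0"
    using tendsto_scaleR[OF t(2) us] by simp
  then have small: "\<forall>\<^sub>F k in sequentially. norm (t k *\<^sub>R us k) < \<rho>"
    by (rule order_tendstoD(2)[OF tendsto_norm_zero pos(1)])
  show ?thesis
  proof (cases "u = 0")
    case True
    have "ball 0 \<rho> \<subseteq> U"
      using U unfolding dir_nbhd_basic_def by (auto simp: True)
    moreover have "\<exists>r>0. ball z r \<subseteq> ball 0 \<rho>" if "norm z < \<rho>" for z :: 'a
      using open_ball[of "0::'a" \<rho>] that unfolding open_contains_ball by auto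
    ultimately show ?thesis
      using small by (elim eventually_mono) (meson order_trans)
  next
    case False
    define S where "S = {z. norm z < \<rho> \<and> norm (norm u *\<^sub>R z - norm z *\<^sub>R u) < \<delta> * norm z * norm u}"
    have S: "open S"
      unfolding S_def by (intro open_Collect_conj open_Collect_less continuous_intros)
    have SU: "S \<subseteq> U"
      using U unfolding S_def dir_nbhd_basic_def by auto
    have "(\<lambda>k. \<delta> * norm (us k) * norm u - norm (norm u *\<^sub>R us k - norm (us k) *\<^sub>R u)) \<longlonglongrightarrow>
        \<delta> * norm u * norm u - norm (norm u *\<^sub>R u - norm u *\<^sub>R u)"
      by (intro tendsto_intros us)
    moreover have "0 < \<delta> * norm u * norm u - norm (norm u *\<^sub>R u - norm u *\<^sub>R u)"
      using False pos(2) by simp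
    ultimately have "\<forall>\<^sub>F k in sequentially.
        0 < \<delta> * norm (us k) * norm u - norm (norm u *\<^sub>R us k - norm (us k) *\<^sub>R u)"
      by (rule order_tendstoD(1))
    with small have "\<forall>\<^sub>F k in sequentially. t k *\<^sub>R us k \<in> S"
    proof eventually_elim
      case (elim k)
      have "norm u *\<^sub>R (t k *\<^sub>R us k) - norm (t k *\<^sub>R us k) *\<^sub>R u
          = t k *\<^sub>R (norm u *\<^sub>R us k - norm (us k) *\<^sub>R u)"
        using t(1)[of k] by (simp add: algebra_simps)
      then have "norm (norm u *\<^sub>R (t k *\<^sub>R us k) - norm (t k *\<^sub>R us k) *\<^sub>R u)
          = t k * norm (norm u *\<^sub>R us k - norm (us k) *\<^sub>R u)"
        using t(1)[of k] by simp
      also have "\<dots> < t k * (\<delta> * norm (us k) * norm u)"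
        using t(1)[of k] elim by (intro mult_strict_left_mono) auto
      also have "\<dots> = \<delta> * norm (t k *\<^sub>R us k) * norm u"
        using t(1)[of k] by simp
      finally show ?case
        using elim by (simp add: S_def)
    qed
    then show ?thesis
      using S SU unfolding open_contains_ball by (elim eventually_mono) (meson order_trans)
  qed
qed

lemma tangent_coneI:
  assumes "x \<in> \<Omega>" "\<And>k. t k > 0" "t \<longlonglongrightarrow> 0" "\<And>k. y k \<in> \<Omega>" "(\<lambda>k. (y k - x) /\<^sub>R t k) \<longlonglongrightarrow> u"
  shows "u \<in> tangent_cone \<Omega> x"
proof -
  have "x + t k *\<^sub>R ((y k - x) /\<^sub>R t k) = y k" for k
    using assms(2)[of k] by simp
  then show ?thesis
    using assms unfolding tangent_cone_def mem_Collect_eq by (metis (no_types, lifting))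
qed

lemma dir_normal_coneI:
  assumes "\<And>k. t k > 0" "t \<longlonglongrightarrow> 0" "(\<lambda>k. (y k - x) /\<^sub>R t k) \<longlonglongrightarrow> u"
    "\<xi>s \<longlonglongrightarrow> \<xi>" "\<And>k. \<xi>s k \<in> regular_normal_cone \<Omega> (y k)"
  shows "\<xi> \<in> dir_normal_cone \<Omega> x u"
proof -
  have "x + t k *\<^sub>R ((y k - x) /\<^sub>R t k) = y k" for k
    using assms(1)[of k] by simp
  then show ?thesis
    using assms unfolding dir_normal_cone_def mem_Collect_eq by (metis (no_types, lifting))
qed

text \<open>The factor \<open>c k\<close> coarsens the scale from \<open>t k\<close> to \<open>t k * c k\<close>, and \<open>\<gamma>\<close> is the part of the direction
  \<open>(h, \<nu>)\<close> that survives: it is \<open>1\<close> when \<open>c\<close> is constantly \<open>1\<close> and \<open>0\<close> when \<open>c\<close> tends to infinity. The points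
  \<open>X k\<close> and \<open>P k\<close>, where the normals live, are so close to \<open>x0 + t k *\<^sub>R hs k\<close> and its image that they approach
  in the same direction.\<close>

lemma directional_limit:
  fixes \<phi> :: "'a::real_inner \<Rightarrow> 'b::real_inner" and g :: "'b \<Rightarrow> ereal"
  assumes t: "\<And>k. t k > 0" and c: "\<And>k. c k \<ge> 1" "(\<lambda>k. t k * c k) \<longlonglongrightarrow> 0" "(\<lambda>k. inverse (c k)) \<longlonglongrightarrow> \<gamma>"
    and hs: "hs \<longlonglongrightarrow> h" and \<nu>s: "\<nu>s \<longlonglongrightarrow> \<nu>"
    and g0: "g (\<phi> x0) = ereal a0"
    and gk: "\<And>k. g (\<phi> (x0 + t k *\<^sub>R hs k)) = ereal (a0 + t k * \<nu>s k)"
    and v: "(\<lambda>k. (\<phi> (x0 + t k *\<^sub>R hs k) - \<phi> x0) /\<^sub>R (t k * c k)) \<longlonglongrightarrow> v"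
    and \<delta>: "\<delta> \<longlonglongrightarrow> 0"
    and X: "\<And>k. norm (X k - (x0 + t k *\<^sub>R hs k)) \<le> t k * \<delta> k"
    and \<phi>X: "\<And>k. norm (\<phi> (X k) - \<phi> (x0 + t k *\<^sub>R hs k)) \<le> t k * \<delta> k"
    and P: "\<And>k. norm (P k - (\<phi> (x0 + t k *\<^sub>R hs k), a0 + t k * \<nu>s k)) \<le> t k * \<delta> k"
    and lim: "\<xi>s \<longlonglongrightarrow> \<xi>" "\<eta>s \<longlonglongrightarrow> \<eta>" "\<beta>s \<longlonglongrightarrow> 1"
    and nor: "\<And>k. (\<xi>s k, - \<eta>s k) \<in> regular_normal_cone (gph \<phi>) (X k, \<phi> (X k))"
      "\<And>k. (\<eta>s k, - \<beta>s k) \<in> regular_normal_cone (epi g) (P k)"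
  shows "v \<in> graph_deriv \<phi> x0 (\<gamma> *\<^sub>R h)"
    and "\<gamma> * \<nu> \<in> graph_deriv_ext g (\<phi> x0) v"
    and "\<xi> \<in> dir_coderiv_set \<phi> x0 (\<gamma> *\<^sub>R h, v) (dir_subdifferential g (\<phi> x0) (v, \<gamma> * \<nu>))"
proof -
  define \<tau> where "\<tau> k = t k * c k" for k
  define x where "x k = x0 + t k *\<^sub>R hs k" for k
  define a where "a k = a0 + t k * \<nu>s k" for k
  have cpos: "c k > 0" for k
    using c(1)[of k] by linarith
  have \<tau>: "\<tau> k > 0" "\<tau> \<longlonglongrightarrow> 0" for k
    using t[of k] cpos[of k] c(2) by (auto simp: \<tau>_def[abs_def])
  have "(\<lambda>k. inverse (c k) *\<^sub>R hs k) \<longlonglongrightarrow> \<gamma> *\<^sub>R h"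
    by (intro tendsto_intros c(3) hs)
  moreover have "(x k - x0) /\<^sub>R \<tau> k = inverse (c k) *\<^sub>R hs k" for k
    using t[of k] by (simp add: x_def \<tau>_def)
  ultimately have xl: "(\<lambda>k. (x k - x0) /\<^sub>R \<tau> k) \<longlonglongrightarrow> \<gamma> *\<^sub>R h"
    by simp
  have "(\<lambda>k. inverse (c k) * \<nu>s k) \<longlonglongrightarrow> \<gamma> * \<nu>"
    by (intro tendsto_intros c(3) \<nu>s)
  moreover have "(a k - a0) /\<^sub>R \<tau> k = inverse (c k) * \<nu>s k" for k
    using t[of k] by (simp add: a_def \<tau>_def)
  ultimately have al: "(\<lambda>k. (a k - a0) /\<^sub>R \<tau> k) \<longlonglongrightarrow> \<gamma> * \<nu>"
    by simp
  have vl: "(\<lambda>k. (\<phi> (x k) - \<phi> x0) /\<^sub>R \<tau> k) \<longlonglongrightarrow> v"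
    using v by (simp add: x_def \<tau>_def)
  have shift: "y /\<^sub>R \<tau> k + (y' - y0) /\<^sub>R \<tau> k = (y + y' - y0) /\<^sub>R \<tau> k"
    for y y' y0 :: "'z::real_normed_vector" and k
    by (simp add: algebra_simps)
  have null: "(\<lambda>k. y k /\<^sub>R \<tau> k) \<longlonglongrightarrow> 0" if y: "\<And>k. norm (y k) \<le> t k * \<delta> k"
    for y :: "nat \<Rightarrow> 'z::real_normed_vector"
  proof (rule Lim_null_comparison[OF _ \<delta>], rule always_eventually, rule allI)
    fix k
    have "0 \<le> t k * \<delta> k"
      using y[of k] norm_ge_zero order_trans by blast
    then have "\<delta> k \<ge> 0"
      using t[of k] by (simp add: zero_le_mult_iff)
    then have "\<delta> k \<le> c k * \<delta> k"
      using mult_right_mono[OF c(1), of "\<delta> k" k] by simp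
    then have "t k * \<delta> k \<le> t k * (c k * \<delta> k)"
      using t[of k] by (intro mult_left_mono) auto
    with y[of k] have "norm (y k) \<le> \<tau> k * \<delta> k"
      by (simp add: \<tau>_def mult.assoc)
    then show "norm (y k /\<^sub>R \<tau> k) \<le> \<delta> k"
      using \<tau>(1)[of k] by (simp add: field_simps)
  qed
  have Xl: "(\<lambda>k. (X k - x0) /\<^sub>R \<tau> k) \<longlonglongrightarrow> \<gamma> *\<^sub>R h"
    using tendsto_add[OF null[of "\<lambda>k. X k - x k"] xl] X
    unfolding shift by (simp add: x_def)
  have \<phi>Xl: "(\<lambda>k. (\<phi> (X k) - \<phi> x0) /\<^sub>R \<tau> k) \<longlonglongrightarrow> v"
    using tendsto_add[OF null[of "\<lambda>k. \<phi> (X k) - \<phi> (x k)"] vl] \<phi>X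
    unfolding shift by (simp add: x_def)
  have qal: "(\<lambda>k. ((\<phi> (x k), a k) - (\<phi> x0, a0)) /\<^sub>R \<tau> k) \<longlonglongrightarrow> (v, \<gamma> * \<nu>)"
    using tendsto_Pair[OF vl al] by simp
  have Pl: "(\<lambda>k. (P k - (\<phi> x0, a0)) /\<^sub>R \<tau> k) \<longlonglongrightarrow> (v, \<gamma> * \<nu>)"
    using tendsto_add[OF null[of "\<lambda>k. P k - (\<phi> (x k), a k)"] qal] P
    unfolding shift by (simp add: x_def a_def)
  have r0: "real_of_ereal (g (\<phi> x0)) = a0"
    by (simp add: g0)
  show "v \<in> graph_deriv \<phi> x0 (\<gamma> *\<^sub>R h)"
    unfolding graph_deriv_def mem_Collect_eq
  proof (rule tangent_coneI[OF _ \<tau>])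
    show "(\<lambda>k. ((x k, \<phi> (x k)) - (x0, \<phi> x0)) /\<^sub>R \<tau> k) \<longlonglongrightarrow> (\<gamma> *\<^sub>R h, v)"
      using tendsto_Pair[OF xl vl] by simp
  qed (auto simp: gph_def)
  show "\<gamma> * \<nu> \<in> graph_deriv_ext g (\<phi> x0) v"
    unfolding graph_deriv_ext_def mem_Collect_eq r0
    by (rule tangent_coneI[OF _ \<tau> _ qal]) (auto simp: gph_ext_def g0 gk x_def a_def)
  have "\<eta> \<in> dir_subdifferential g (\<phi> x0) (v, \<gamma> * \<nu>)"
    unfolding dir_subdifferential_def mem_Collect_eq r0
    by (rule dir_normal_coneI[OF \<tau> Pl _ nor(2)]) (intro tendsto_intros lim)
  moreover have "\<xi> \<in> dir_coderiv \<phi> x0 (\<gamma> *\<^sub>R h, v) \<eta>"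
    unfolding dir_coderiv_def mem_Collect_eq
  proof (rule dir_normal_coneI[OF \<tau> _ _ nor(1)])
    show "(\<lambda>k. ((X k, \<phi> (X k)) - (x0, \<phi> x0)) /\<^sub>R \<tau> k) \<longlonglongrightarrow> (\<gamma> *\<^sub>R h, v)"
      using tendsto_Pair[OF Xl \<phi>Xl] by simp
    show "(\<lambda>k. (\<xi>s k, - \<eta>s k)) \<longlonglongrightarrow> (\<xi>, - \<eta>)"
      by (intro tendsto_intros lim)
  qed
  ultimately show "\<xi> \<in> dir_coderiv_set \<phi> x0 (\<gamma> *\<^sub>R h, v) (dir_subdifferential g (\<phi> x0) (v, \<gamma> * \<nu>))"
    unfolding dir_coderiv_set_def by blast
qed

lemma convergent_subsequence_or_blow_up:
  fixes D :: "nat \<Rightarrow> 'a::euclidean_space"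
  obtains (convergent) r v where "strict_mono r" "(D \<circ> r) \<longlonglongrightarrow> v"
  | (blow_up) r v where "strict_mono r" "norm v = 1" "\<And>k. norm (D (r k)) \<ge> 1"
      "filterlim (\<lambda>k. norm (D (r k))) at_top sequentially" "(\<lambda>k. sgn (D (r k))) \<longlonglongrightarrow> v"
proof (cases "filterlim (\<lambda>k. norm (D k)) at_top sequentially")
  case True
  then obtain K where K: "\<And>k. k \<ge> K \<Longrightarrow> norm (D k) \<ge> 1"
    unfolding filterlim_at_top eventually_sequentially by blast
  have "\<forall>k. sgn (D (k + K)) \<in> sphere 0 1"
  proof
    fix k
    have "D (k + K) \<noteq> 0"
      using K[of "k + K"] by auto
    then show "sgn (D (k + K)) \<in> sphere 0 1"
      by (simp add: norm_sgn)
  qed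
  then obtain v r where v: "v \<in> sphere 0 1" "strict_mono r" "((\<lambda>k. sgn (D (k + K))) \<circ> r) \<longlonglongrightarrow> v"
    using compact_sphere[of "0::'a" 1] unfolding compact_def by metis
  have r: "strict_mono (\<lambda>k. r k + K)"
    using v(2) by (simp add: strict_mono_def)
  show thesis
    by (rule blow_up[OF r])
      (use v K filterlim_compose[OF True filterlim_subseq[OF r]] in \<open>auto simp: o_def\<close>)
next
  case False
  then obtain M where "\<not> (\<forall>\<^sub>F k in sequentially. M \<le> norm (D k))"
    unfolding filterlim_at_top by blast
  then have "\<exists>\<^sub>F k in sequentially. norm (D k) < M"
    by (simp add: frequently_def not_less)
  then have "infinite {k. norm (D k) < M}"
    by (simp add: frequently_cofinite flip: cofinite_eq_sequentially)
  then obtain s :: "nat \<Rightarrow> nat" where s: "strict_mono s" "\<And>k. norm (D (s k)) < M"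
    using infinite_enumerate[of "{k. norm (D k) < M}"] by auto
  then have "bounded (range (D \<circ> s))"
    unfolding bounded_iff by (auto intro!: exI[of _ M] less_imp_le)
  then obtain v r where "strict_mono r" "((D \<circ> s) \<circ> r) \<longlonglongrightarrow> v"
    using bounded_imp_convergent_subsequence by blast
  then show thesis
    using convergent[of "s \<circ> r" v] s(1) by (simp add: o_assoc strict_mono_o)
qed

section \<open>The chain rule\<close>

text \<open>The set of \<open>z\<close> with \<open>(0, 0) \<in> F z\<close> is the epigraph of \<open>g \<circ> \<phi>\<close>, and every \<open>p \<in> epi g\<close> bounds the distance
  from \<open>(0, 0)\<close> to \<open>F z\<close>.\<close>

lemma subregular_epi_imp_distance_bound:
  fixes \<phi> :: "'a::real_normed_vector \<Rightarrow> 'b::real_normed_vector"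
  assumes F: "\<And>x \<alpha>. F (x, \<alpha>) = (\<lambda>w. w - (\<phi> x, \<alpha>)) ` epi g"
    and "metrically_subregular_dir F z0 (0, 0) u"
  obtains \<kappa> U where "\<kappa> > 0" "dir_nbhd u U"
    "\<And>z p. z - z0 \<in> U \<Longrightarrow> p \<in> epi g \<Longrightarrow>
       edist_set (epi (g \<circ> \<phi>)) z \<le> ereal (\<kappa> * norm ((\<phi> (fst z), snd z) - p))"
proof -
  obtain \<kappa> U where "\<kappa> > 0" and U: "dir_nbhd u U"
    and sub: "\<forall>z \<in> (+) z0 ` U.
       edist_set {y. (0, 0) \<in> F y} z \<le> ereal \<kappa> * edist_set (F z) (0, 0)"
    using assms(2) unfolding metrically_subregular_dir_def by blast
  have F0: "{y. (0, 0) \<in> F y} = epi (g \<circ> \<phi>)"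
  proof -
    have "(0, 0) \<in> F (y, b) \<longleftrightarrow> (y, b) \<in> epi (g \<circ> \<phi>)" for y b
      unfolding F epi_def by force
    then show ?thesis
      by auto
  qed
  have "edist_set (epi (g \<circ> \<phi>)) z \<le> ereal (\<kappa> * norm ((\<phi> (fst z), snd z) - p))"
    if z: "z - z0 \<in> U" and p: "p \<in> epi g" for z p
  proof -
    have "z \<in> (+) z0 ` U"
      using z by (rule rev_image_eqI) simp
    then have "edist_set (epi (g \<circ> \<phi>)) z \<le> ereal \<kappa> * edist_set (F z) (0, 0)"
      using sub unfolding F0 by blast
    also have "p - (\<phi> (fst z), snd z) \<in> F z"
      using p F[of "fst z" "snd z"] by simp
    then have "edist_set (F z) (0, 0) \<le> ereal (dist (0, 0) (p - (\<phi> (fst z), snd z)))"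
      unfolding edist_set_def by (rule INF_lower)
    then have "ereal \<kappa> * edist_set (F z) (0, 0) \<le> ereal \<kappa> * ereal (dist (0, 0) (p - (\<phi> (fst z), snd z)))"
      using \<open>\<kappa> > 0\<close> by (intro ereal_mult_left_mono) auto
    also have "\<dots> = ereal (\<kappa> * norm ((\<phi> (fst z), snd z) - p))"
      by (simp add: dist_norm norm_minus_commute flip: zero_prod_def)
    finally show ?thesis .
  qed
  with \<open>\<kappa> > 0\<close> U show thesis
    by (rule that)
qed

text \<open>The two cases are distinguished by whether the difference quotients of \<open>\<phi>\<close> along a subsequence converge or
  blow up. Calmness bounds these quotients, so it excludes the second case.\<close>

lemma dir_subdifferential_chain_alternative:
  fixes \<phi> :: "'a::euclidean_space \<Rightarrow> 'b::euclidean_space"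
  assumes \<phi>: "continuous_on UNIV \<phi>" and g: "lower_semicontinuous g"
    and fin: "\<bar>g (\<phi> x0)\<bar> \<noteq> \<infinity>"
    and F: "\<And>x \<alpha>. F (x, \<alpha>) = (\<lambda>w. w - (\<phi> x, \<alpha>)) ` epi g"
    and subreg: "metrically_subregular_dir F (x0, real_of_ereal (g (\<phi> x0))) (0, 0) (h, \<nu>)"
    and \<xi>: "\<xi> \<in> dir_subdifferential (g \<circ> \<phi>) x0 (h, \<nu>)"
  obtains (bounded_rate) v where "v \<in> graph_deriv \<phi> x0 h" "\<nu> \<in> graph_deriv_ext g (\<phi> x0) v"
      "\<xi> \<in> dir_coderiv_set \<phi> x0 (h, v) (dir_subdifferential g (\<phi> x0) (v, \<nu>))"
  | (unbounded_rate) v where "v \<in> graph_deriv \<phi> x0 0" "norm v = 1" "0 \<in> graph_deriv_ext g (\<phi> x0) v"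
      "\<xi> \<in> dir_coderiv_set \<phi> x0 (0, v) (dir_subdifferential g (\<phi> x0) (v, 0))"
      "\<not> calm_dir \<phi> x0 h"
proof -
  define a0 where "a0 = real_of_ereal (g (\<phi> x0))"
  have g0: "g (\<phi> x0) = ereal a0"
    using fin by (simp add: a0_def ereal_real)
  have "\<xi> \<in> {\<xi>. (\<xi>, - 1) \<in> dir_normal_cone (epi (g \<circ> \<phi>)) (x0, a0) (h, \<nu>)}"
    using \<xi> unfolding dir_subdifferential_def by (simp add: a0_def)
  then obtain t us \<zeta>s where t: "\<And>k. t k > 0" "t \<longlonglongrightarrow> 0" and us: "us \<longlonglongrightarrow> (h, \<nu>)"
    and \<zeta>s: "\<zeta>s \<longlonglongrightarrow> (\<xi>, - 1)"
    and nor: "\<And>k. \<zeta>s k \<in> regular_normal_cone (epi (g \<circ> \<phi>)) ((x0, a0) + t k *\<^sub>R us k)"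
    unfolding dir_normal_cone_def by auto
  define hs \<nu>s where "hs k = fst (us k)" and "\<nu>s k = snd (us k)" for k
  define \<xi>s \<beta>s where "\<xi>s k = fst (\<zeta>s k)" and "\<beta>s k = - snd (\<zeta>s k)" for k
  have hs: "hs \<longlonglongrightarrow> h" and \<nu>s: "\<nu>s \<longlonglongrightarrow> \<nu>"
    using tendsto_fst[OF us] tendsto_snd[OF us] by (simp_all add: hs_def[abs_def] \<nu>s_def[abs_def])
  have \<xi>s: "\<xi>s \<longlonglongrightarrow> \<xi>" and \<beta>s: "\<beta>s \<longlonglongrightarrow> 1"
    using tendsto_fst[OF \<zeta>s] tendsto_minus[OF tendsto_snd[OF \<zeta>s]]
    by (simp_all add: \<xi>s_def[abs_def] \<beta>s_def[abs_def])
  define x a where "x k = x0 + t k *\<^sub>R hs k" and "a k = a0 + t k * \<nu>s k" for k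
  have nor: "(\<xi>s k, - \<beta>s k) \<in> regular_normal_cone (epi (g \<circ> \<phi>)) (x k, a k)" for k
  proof -
    have "(x0, a0) + t k *\<^sub>R us k = (x k, a k)" "\<zeta>s k = (\<xi>s k, - \<beta>s k)"
      by (auto simp: x_def a_def hs_def \<nu>s_def \<xi>s_def \<beta>s_def prod_eq_iff)
    with nor[of k] show ?thesis
      by simp
  qed

  obtain \<kappa> U where "\<kappa> > 0" and U: "dir_nbhd (h, \<nu>) U"
    and sub: "\<And>z p. z - (x0, a0) \<in> U \<Longrightarrow> p \<in> epi g \<Longrightarrow>
      edist_set (epi (g \<circ> \<phi>)) z \<le> ereal (\<kappa> * norm ((\<phi> (fst z), snd z) - p))"
    using subregular_epi_imp_distance_bound[OF F subreg] unfolding a0_def by blast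

  have "\<forall>\<^sub>F k in sequentially. \<beta>s k > 0"
    using \<beta>s by (rule order_tendstoD) simp
  moreover have "\<forall>\<^sub>F k in sequentially. \<exists>r>0. ball (t k *\<^sub>R us k) r \<subseteq> U"
    using U t us by (rule dir_nbhd_absorbs)
  ultimately have "\<forall>\<^sub>F k in sequentially. \<beta>s k > 0 \<and> (\<exists>r>0. ball (t k *\<^sub>R us k) r \<subseteq> U)"
    by (rule eventually_conj)
  then obtain K where K: "\<And>k. k \<ge> K \<Longrightarrow> \<beta>s k > 0"
    "\<And>k. k \<ge> K \<Longrightarrow> \<exists>r>0. ball (t k *\<^sub>R us k) r \<subseteq> U"
    unfolding eventually_sequentially by blast
  define \<epsilon> where "\<epsilon> k = 1 / real (Suc k)" for k
  have \<epsilon>: "\<epsilon> k > 0" "\<epsilon> k \<le> 1" "\<epsilon> \<longlonglongrightarrow> 0" for k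
    using LIMSEQ_inverse_real_of_nat by (auto simp: \<epsilon>_def[abs_def] inverse_eq_divide)
  \<comment> \<open>Tolerances \<open>t k * \<epsilon> k\<close>, of smaller order than \<open>t k\<close>, leave the directions of approach unchanged.\<close>
  define Q where "Q k x' p \<xi>' \<eta> \<beta>' \<longleftrightarrow>
    norm (x' - x k) < t k * \<epsilon> k \<and> norm (\<phi> x' - \<phi> (x k)) < t k * \<epsilon> k \<and>
    norm (p - (\<phi> (x k), a k)) < t k * \<epsilon> k \<and>
    norm (\<xi>' - \<xi>s k) \<le> 2 * \<epsilon> k \<and> \<bar>\<beta>' - \<beta>s k\<bar> \<le> 2 * \<epsilon> k \<and>
    norm \<eta> \<le> (norm (\<xi>s k, - \<beta>s k) + \<epsilon> k) * \<kappa> \<and>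
    (\<xi>', - \<eta>) \<in> regular_normal_cone (gph \<phi>) (x', \<phi> x') \<and>
    (\<eta>, - \<beta>') \<in> regular_normal_cone (epi g) p" for k x' p \<xi>' \<eta> \<beta>'
  have "\<exists>x' p \<xi>' \<eta> \<beta>'. Q k x' p \<xi>' \<eta> \<beta>'" if "k \<ge> K" for k
  proof -
    obtain r where "r > 0" and r: "ball (t k *\<^sub>R us k) r \<subseteq> U"
      using K(2)[OF \<open>k \<ge> K\<close>] by blast
    have "z - (x0, a0) \<in> U" if "z \<in> ball (x k, a k) r" for z
    proof -
      have "(x k, a k) - (x0, a0) = t k *\<^sub>R us k"
        by (auto simp: x_def a_def hs_def \<nu>s_def prod_eq_iff)
      moreover have "dist ((x k, a k) - (x0, a0)) (z - (x0, a0)) < r"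
        using that by (simp only: mem_ball dist_norm diff_diff_eq2 diff_add_cancel)
      ultimately show ?thesis
        using r by auto
    qed
    then have "edist_set (epi (g \<circ> \<phi>)) z \<le> ereal (\<kappa> * norm ((\<phi> (fst z), snd z) - p))"
      if "z \<in> ball (x k, a k) r" "p \<in> epi g" for z p
      using sub that by blast
    then show ?thesis
      unfolding Q_def
      using fuzzy_normals_of_composite[OF \<phi> g nor \<open>\<kappa> > 0\<close> \<open>r > 0\<close> \<epsilon>(1)
          mult_pos_pos[OF t(1) \<epsilon>(1)], of k k k k]
      by (smt (verit, ccfv_threshold))
  qed
  then have "\<forall>k. \<exists>x' p \<xi>' \<eta> \<beta>'. Q (k + K) x' p \<xi>' \<eta> \<beta>'"
    by simp
  then obtain X P \<Xi> H B where Q: "\<And>k. Q (k + K) (X k) (P k) (\<Xi> k) (H k) (B k)"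
    by metis

  have "bounded (range H)"
  proof -
    have "(\<lambda>k. norm (\<xi>s k, - \<beta>s k)) \<longlonglongrightarrow> norm (\<xi>, - 1 :: real)"
      by (intro tendsto_intros \<xi>s \<beta>s)
    then have "bounded (range (\<lambda>k. norm (\<xi>s k, - \<beta>s k)))"
      by (rule convergent_imp_bounded)
    then obtain M where M: "\<And>k. norm (\<xi>s k, - \<beta>s k) \<le> M"
      unfolding bounded_iff by fastforce
    have "norm (H k) \<le> (M + 1) * \<kappa>" for k
    proof -
      have "norm (H k) \<le> (norm (\<xi>s (k + K), - \<beta>s (k + K)) + \<epsilon> (k + K)) * \<kappa>"
        using Q[of k] unfolding Q_def by blast
      also have "\<dots> \<le> (M + 1) * \<kappa>"
        using M[of "k + K"] \<epsilon>(2)[of "k + K"] \<open>\<kappa> > 0\<close> by (intro mult_right_mono add_mono) auto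
      finally show ?thesis .
    qed
    then show ?thesis
      unfolding bounded_iff by blast
  qed
  then obtain \<eta> s0 where s0: "strict_mono s0" "(H \<circ> s0) \<longlonglongrightarrow> \<eta>"
    using bounded_imp_convergent_subsequence by blast

  define D where "D k = (\<phi> (x k) - \<phi> x0) /\<^sub>R t k" for k
  have limit: "v \<in> graph_deriv \<phi> x0 (\<gamma> *\<^sub>R h) \<and> \<gamma> * \<nu> \<in> graph_deriv_ext g (\<phi> x0) v \<and>
      \<xi> \<in> dir_coderiv_set \<phi> x0 (\<gamma> *\<^sub>R h, v) (dir_subdifferential g (\<phi> x0) (v, \<gamma> * \<nu>))"
    if r: "strict_mono r" and c: "\<And>k. c k \<ge> 1" "(\<lambda>k. t (s0 (r k) + K) * c k) \<longlonglongrightarrow> 0"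
      "(\<lambda>k. inverse (c k)) \<longlonglongrightarrow> \<gamma>" and v: "(\<lambda>k. D (s0 (r k) + K) /\<^sub>R c k) \<longlonglongrightarrow> v"
    for r \<gamma> v and c :: "nat \<Rightarrow> real"
  proof -
    let ?j = "\<lambda>k. s0 (r k) + K"
    have j0: "strict_mono (\<lambda>k. s0 (r k))"
      using s0(1) r by (simp add: strict_mono_def)
    then have j: "filterlim ?j sequentially sequentially"
      by (intro filterlim_subseq) (simp add: strict_mono_def)
    have \<Xi>: "(\<lambda>k. \<Xi> (s0 (r k))) \<longlonglongrightarrow> \<xi>"
    proof -
      have "(\<lambda>k. \<Xi> (s0 (r k)) - \<xi>s (?j k)) \<longlonglongrightarrow> 0"
      proof (rule Lim_null_comparison)
        show "\<forall>\<^sub>F k in sequentially. norm (\<Xi> (s0 (r k)) - \<xi>s (?j k)) \<le> 2 * \<epsilon> (?j k)"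
          using Q unfolding Q_def by (intro always_eventually allI) blast
        show "(\<lambda>k. 2 * \<epsilon> (?j k)) \<longlonglongrightarrow> 0"
          using filterlim_compose[OF \<epsilon>(3) j] by (intro tendsto_mult_right_zero)
      qed
      from tendsto_add[OF this filterlim_compose[OF \<xi>s j]] show ?thesis
        by simp
    qed
    have B: "(\<lambda>k. B (s0 (r k))) \<longlonglongrightarrow> 1"
    proof -
      have "(\<lambda>k. B (s0 (r k)) - \<beta>s (?j k)) \<longlonglongrightarrow> 0"
      proof (rule Lim_null_comparison)
        show "\<forall>\<^sub>F k in sequentially. norm (B (s0 (r k)) - \<beta>s (?j k)) \<le> 2 * \<epsilon> (?j k)"
          using Q unfolding Q_def real_norm_def by (intro always_eventually allI) blast
        show "(\<lambda>k. 2 * \<epsilon> (?j k)) \<longlonglongrightarrow> 0"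
          using filterlim_compose[OF \<epsilon>(3) j] by (intro tendsto_mult_right_zero)
      qed
      from tendsto_add[OF this filterlim_compose[OF \<beta>s j]] show ?thesis
        by simp
    qed
    have H: "(\<lambda>k. H (s0 (r k))) \<longlonglongrightarrow> \<eta>"
      using LIMSEQ_subseq_LIMSEQ[OF s0(2) r] by (simp add: o_def)
    have gk: "g (\<phi> (x0 + t (?j k) *\<^sub>R hs (?j k))) = ereal (a0 + t (?j k) * \<nu>s (?j k))" for k
      using regular_normal_epi_on_graph[OF nor K(1), of "?j k"] by (simp add: x_def a_def)
    have v': "(\<lambda>k. (\<phi> (x0 + t (?j k) *\<^sub>R hs (?j k)) - \<phi> x0) /\<^sub>R (t (?j k) * c k)) \<longlonglongrightarrow> v"
      using v by (simp add: D_def x_def mult.commute)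
    have q: "norm (X (s0 (r k)) - (x0 + t (?j k) *\<^sub>R hs (?j k))) \<le> t (?j k) * \<epsilon> (?j k)"
      "norm (\<phi> (X (s0 (r k))) - \<phi> (x0 + t (?j k) *\<^sub>R hs (?j k))) \<le> t (?j k) * \<epsilon> (?j k)"
      "norm (P (s0 (r k)) - (\<phi> (x0 + t (?j k) *\<^sub>R hs (?j k)), a0 + t (?j k) * \<nu>s (?j k)))
        \<le> t (?j k) * \<epsilon> (?j k)"
      "(\<Xi> (s0 (r k)), - H (s0 (r k))) \<in> regular_normal_cone (gph \<phi>) (X (s0 (r k)), \<phi> (X (s0 (r k))))"
      "(H (s0 (r k)), - B (s0 (r k))) \<in> regular_normal_cone (epi g) (P (s0 (r k)))" for k
      using Q[of "s0 (r k)"] unfolding Q_def x_def a_def by (blast intro: less_imp_le)+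
    note lims = t(1) c filterlim_compose[OF hs j] filterlim_compose[OF \<nu>s j] g0 gk v'
      filterlim_compose[OF \<epsilon>(3) j] q(1-3) \<Xi> H B q(4,5)
    show ?thesis
      using directional_limit[OF lims] by blast
  qed

  show thesis
  proof (cases rule: convergent_subsequence_or_blow_up[of "\<lambda>k. D (s0 k + K)"])
    case (convergent r v)
    have j: "strict_mono (\<lambda>k. s0 (r k) + K)"
      using s0(1) convergent(1) by (simp add: strict_mono_def)
    show thesis
      using bounded_rate[of v] limit[OF convergent(1), of "\<lambda>_. 1" 1 v] convergent(2)
        filterlim_compose[OF t(2) filterlim_subseq[OF j]]
      by (simp add: o_def)
  next
    case (blow_up r v)
    let ?j = "\<lambda>k. s0 (r k) + K"
    let ?c = "\<lambda>k. norm (D (?j k))"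
    have "strict_mono ?j"
      using s0(1) blow_up(1) by (simp add: strict_mono_def)
    then have j: "filterlim ?j sequentially sequentially"
      by (rule filterlim_subseq)
    have "x \<longlonglongrightarrow> x0 + 0 *\<^sub>R h"
      unfolding x_def by (intro tendsto_intros t hs)
    then have "(\<lambda>k. \<phi> (x k)) \<longlonglongrightarrow> \<phi> x0"
      using \<phi> by (auto intro: continuous_on_tendsto_compose)
    then have "(\<lambda>k. norm (\<phi> (x (?j k)) - \<phi> x0)) \<longlonglongrightarrow> 0"
      by (intro tendsto_norm_zero LIM_zero filterlim_compose[OF _ j])
    moreover have "t (?j k) * ?c k = norm (\<phi> (x (?j k)) - \<phi> x0)" for k
      using t(1)[of "?j k"] by (simp add: D_def)
    ultimately have tc: "(\<lambda>k. t (?j k) * ?c k) \<longlonglongrightarrow> 0"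
      by simp
    have inv: "(\<lambda>k. inverse (?c k)) \<longlonglongrightarrow> 0"
      by (rule tendsto_inverse_0_at_top[OF blow_up(4)])
    have "(\<lambda>k. D (?j k) /\<^sub>R ?c k) \<longlonglongrightarrow> v"
      using blow_up(5) by (simp add: sgn_div_norm)
    from limit[OF blow_up(1) blow_up(3) tc inv this] blow_up(2)
    have "v \<in> graph_deriv \<phi> x0 0" "norm v = 1" "0 \<in> graph_deriv_ext g (\<phi> x0) v"
      "\<xi> \<in> dir_coderiv_set \<phi> x0 (0, v) (dir_subdifferential g (\<phi> x0) (v, 0))"
      by auto
    moreover have "\<not> calm_dir \<phi> x0 h"
    proof
      assume "calm_dir \<phi> x0 h"
      then obtain \<kappa>' V where "\<kappa>' > 0" and V: "dir_nbhd h V"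
        and calm: "\<forall>y \<in> (+) x0 ` V. norm (\<phi> y - \<phi> x0) \<le> \<kappa>' * norm (y - x0)"
        unfolding calm_dir_def by blast
      have "\<forall>\<^sub>F k in sequentially. norm (D k) \<le> \<kappa>' * norm (hs k)"
        using dir_nbhd_absorbs[OF V t hs]
      proof eventually_elim
        case (elim k)
        then have "x k \<in> (+) x0 ` V"
          unfolding x_def by (auto intro!: imageI)
        with calm have "norm (\<phi> (x k) - \<phi> x0) \<le> \<kappa>' * norm (x k - x0)"
          by blast
        moreover have "norm (x k - x0) = t k * norm (hs k)"
          using t(1)[of k] by (simp add: x_def)
        moreover have "t k * norm (D k) = norm (\<phi> (x k) - \<phi> x0)"
          using t(1)[of k] by (simp add: D_def)
        ultimately have "t k * norm (D k) \<le> t k * (\<kappa>' * norm (hs k))"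
          by (simp add: mult.left_commute)
        then show ?case
          using t(1)[of k] by (rule mult_left_le_imp_le)
      qed
      moreover have "\<forall>\<^sub>F k in sequentially. \<kappa>' * norm (hs k) < \<kappa>' * norm h + 1"
        by (rule order_tendstoD(2)[of _ "\<kappa>' * norm h"]) (auto intro!: tendsto_intros hs)
      ultimately have "\<forall>\<^sub>F k in sequentially. norm (D k) < \<kappa>' * norm h + 1"
        by eventually_elim linarith
      then have "\<forall>\<^sub>F k in sequentially. ?c k < \<kappa>' * norm h + 1"
        using j by (rule eventually_compose_filterlim)
      moreover have "\<forall>\<^sub>F k in sequentially. ?c k \<ge> \<kappa>' * norm h + 1"
        using blow_up(4) unfolding filterlim_at_top by blast
      ultimately have "\<forall>\<^sub>F k :: nat in sequentially. False"
        by eventually_elim linarith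
      then show False
        by simp
    qed
    ultimately show thesis
      by (rule unbounded_rate)
  qed
qed

theorem theorem4p1:
  fixes \<phi> :: "real ^ 'n \<Rightarrow> real ^ 'm"
    and g :: "real ^ 'm \<Rightarrow> ereal"
    and f :: "real ^ 'n \<Rightarrow> ereal"
    and x0 h :: "real ^ 'n"
    and \<nu> :: real
    and F :: "(real ^ 'n) \<times> real \<Rightarrow> ((real ^ 'm) \<times> real) set"
  assumes "continuous_on UNIV \<phi>"
    and "lower_semicontinuous g"
    and "\<bar>g (\<phi> x0)\<bar> \<noteq> \<infinity>"
    and "f = g \<circ> \<phi>"
    and "\<And>x \<alpha>. F (x, \<alpha>) = (\<lambda>w. w - (\<phi> x, \<alpha>)) ` epi g"
    and "metrically_subregular_dir F (x0, real_of_ereal (f x0)) (0, 0) (h, \<nu>)"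
  shows "dir_subdifferential f x0 (h, \<nu>) \<subseteq>
           (\<Union>v \<in> {v. v \<in> graph_deriv \<phi> x0 h \<and> \<nu> \<in> graph_deriv_ext g (\<phi> x0) v}.
              dir_coderiv_set \<phi> x0 (h, v) (dir_subdifferential g (\<phi> x0) (v, \<nu>))) \<union>
           (\<Union>v \<in> {v. v \<in> graph_deriv \<phi> x0 0 \<inter> sphere 0 1 \<and> 0 \<in> graph_deriv_ext g (\<phi> x0) v}.
              dir_coderiv_set \<phi> x0 (0, v) (dir_subdifferential g (\<phi> x0) (v, 0)))
       \<and> (calm_dir \<phi> x0 h \<longrightarrow>
           dir_subdifferential f x0 (h, \<nu>) \<subseteq>
           (\<Union>v \<in> {v. v \<in> graph_deriv \<phi> x0 h \<and> \<nu> \<in> graph_deriv_ext g (\<phi> x0) v}.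
              dir_coderiv_set \<phi> x0 (h, v) (dir_subdifferential g (\<phi> x0) (v, \<nu>))))"
    (is "_ \<subseteq> ?A \<union> ?B \<and> _")
proof -
  have alt: "\<xi> \<in> ?A \<or> (\<xi> \<in> ?B \<and> \<not> calm_dir \<phi> x0 h)"
    if \<xi>: "\<xi> \<in> dir_subdifferential f x0 (h, \<nu>)" for \<xi>
  proof (cases rule: dir_subdifferential_chain_alternative[OF assms(1,2,3,5)
        assms(6)[unfolded assms(4) comp_apply] \<xi>[unfolded assms(4)],
        case_names bounded_rate unbounded_rate])
    case (bounded_rate v)
    then show ?thesis
      by blast
  next
    case (unbounded_rate v)
    then have "\<xi> \<in> ?B"
      by auto
    with unbounded_rate show ?thesis
      by blast
  qed
  show ?thesis
  proof (intro conjI impI subsetI)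
    fix \<xi>
    assume "\<xi> \<in> dir_subdifferential f x0 (h, \<nu>)"
    from alt[OF this] show "\<xi> \<in> ?A \<union> ?B"
      by blast
  next
    fix \<xi>
    assume "calm_dir \<phi> x0 h" "\<xi> \<in> dir_subdifferential f x0 (h, \<nu>)"
    with alt[of \<xi>] show "\<xi> \<in> ?A"
      by blast
  qed
qed

end
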